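(* There exists a point $[\mu]_{B(\Delta)}$ in $B(\Delta)$ that contains more than one extremal Beltrami coefficient and such that $[\mu]_{B(\Delta)}$ contains no extremal Teichmüller Beltrami coefficient.
   Context: Let $\Delta=\{z\in\mathbb{C}:|z|<1\}$, and let $A(\Delta)$ be the Banach space of holomorphic functions $\varphi$ on $\Delta$ with $\|\varphi\|=\iint_\Delta|\varphi(z)|\,dx\,dy<\infty$. Two elements $\mu,\nu\in L^\infty(\Delta)$ (complex-valued functions) are infinitesimally equivalent if $\iint_\Delta\mu\phi\,dx\,dy=\iint_\Delta\nu\phi\,dx\,dy$ for all $\phi\in A(\Delta)$. Let $N(\Delta)$ be the set of elements of $L^\infty(\Delta)$ infinitesimally equivalent to $0$; then $B(\Delta)=L^\infty(\Delta)/N(\Delta)$, and $[\mu]_{B(\Delta)}$ denotes the set of all $\nu\in L^\infty(\Delta)$ infinitesimally equivalent to $\mu$. An element $\mu$ is extremal in $[\mu]_{B(\Delta)}$ if $\|\mu\|_\infty=\inf\{\|\nu\|_\infty:\nu\in[\mu]_{B(\Delta)}\}$; it is called an extremal Beltrami coefficient if moreover $\|\mu\|_\infty<1$. A Teichmüller Beltrami coefficient is a Beltrami coefficient (an element of $L^\infty(\Delta)$ of norm less than $1$) of the form $\mu(z)=k\,\overline{\varphi(z)}/|\varphi(z)|$, where $k\in[0,1)$ is a constant and $\varphi\not\equiv0$ is meromorphic in $\Delta$. Functions in $L^\infty$ are identified when they agree a.e. *)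

theory Defs
  imports "HOL-Probability.Essential_Supremum" "HOL-Complex_Analysis.Meromorphic"
begin

abbreviation disc :: "complex set" where
  "disc \<equiv> ball 0 1"

abbreviation disc_measure :: "complex measure" where
  "disc_measure \<equiv> lebesgue_on disc"

(* Elements of L^infinity and of A are represented by total functions on the complex plane whose
   values outside the disc are irrelevant.  No quotient by a.e. equality is taken: distinctness
   of elements of L^infinity has to be expressed with Linf_eq below. *)
definition Linf_norm :: "(complex \<Rightarrow> complex) \<Rightarrow> ereal" where
  "Linf_norm \<mu> = esssup disc_measure (\<lambda>z. ereal (norm (\<mu> z)))"

definition Linf :: "(complex \<Rightarrow> complex) set" where
  "Linf = {\<mu>. \<mu> \<in> borel_measurable disc_measure \<and> Linf_norm \<mu> < \<infinity>}"

definition Linf_eq :: "(complex \<Rightarrow> complex) \<Rightarrow> (complex \<Rightarrow> complex) \<Rightarrow> bool" where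
  "Linf_eq \<mu> \<nu> \<longleftrightarrow> (AE z in disc_measure. \<mu> z = \<nu> z)"

definition A_disc :: "(complex \<Rightarrow> complex) set" where
  "A_disc = {\<phi>. \<phi> holomorphic_on disc \<and> integrable disc_measure \<phi>}"

definition inf_equiv :: "((complex \<Rightarrow> complex) \<times> (complex \<Rightarrow> complex)) set" where
  "inf_equiv = {(\<mu>, \<nu>). \<mu> \<in> Linf \<and> \<nu> \<in> Linf \<and>
     (\<forall>\<phi>\<in>A_disc. (LINT z|disc_measure. \<mu> z * \<phi> z) = (LINT z|disc_measure. \<nu> z * \<phi> z))}"

definition N_disc :: "(complex \<Rightarrow> complex) set" where
  "N_disc = inf_equiv `` {\<lambda>_. 0}"

abbreviation B_class :: "(complex \<Rightarrow> complex) \<Rightarrow> (complex \<Rightarrow> complex) set" where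
  "B_class \<mu> \<equiv> inf_equiv `` {\<mu>}"

(* The lemmas inf_equiv_iff_diff and equiv_inf_equiv identify this with the quotient of
   L^infinity by the subspace N_disc. *)
definition B_disc :: "(complex \<Rightarrow> complex) set set" where
  "B_disc = Linf // inf_equiv"

definition extremal :: "(complex \<Rightarrow> complex) \<Rightarrow> bool" where
  "extremal \<mu> \<longleftrightarrow> \<mu> \<in> Linf \<and> Linf_norm \<mu> = (INF \<nu>\<in>B_class \<mu>. Linf_norm \<nu>)"

definition beltrami_coefficient :: "(complex \<Rightarrow> complex) \<Rightarrow> bool" where
  "beltrami_coefficient \<mu> \<longleftrightarrow> \<mu> \<in> Linf \<and> Linf_norm \<mu> < 1"

definition extremal_beltrami_coefficient :: "(complex \<Rightarrow> complex) \<Rightarrow> bool" where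
  "extremal_beltrami_coefficient \<mu> \<longleftrightarrow> extremal \<mu> \<and> beltrami_coefficient \<mu>"

(* The values of a function that is meromorphic_on a set are arbitrary on a discrete subset, so
   not being identically zero means not vanishing off a discrete subset; for the same reason
   (and because of the zeros and poles of the function) the equation is required almost
   everywhere only. *)
definition teichmueller_beltrami_coefficient :: "(complex \<Rightarrow> complex) \<Rightarrow> bool" where
  "teichmueller_beltrami_coefficient \<mu> \<longleftrightarrow> beltrami_coefficient \<mu> \<and>
     (\<exists>k::real. \<exists>\<phi>. 0 \<le> k \<and> k < 1 \<and> \<phi> meromorphic_on disc \<and>
        \<not> (\<forall>\<^sub>\<approx>z\<in>disc. \<phi> z = 0) \<and>
        (AE z in disc_measure. \<mu> z = of_real k * cnj (\<phi> z) / of_real (norm (\<phi> z))))"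

lemma Linf_iff_bounded:
  "\<mu> \<in> Linf \<longleftrightarrow>
     \<mu> \<in> borel_measurable disc_measure \<and> (\<exists>C::real. AE z in disc_measure. norm (\<mu> z) \<le> C)"
proof safe
  assume "\<mu> \<in> Linf"
  then have meas: "\<mu> \<in> borel_measurable disc_measure" and fin: "Linf_norm \<mu> < \<infinity>"
    by (auto simp: Linf_def)
  show "\<mu> \<in> borel_measurable disc_measure" by fact
  from fin obtain C :: real where C: "Linf_norm \<mu> \<le> ereal C"
    by (cases "Linf_norm \<mu>") auto
  have "AE z in disc_measure. ereal (norm (\<mu> z)) \<le> Linf_norm \<mu>"
    unfolding Linf_norm_def by (rule esssup_AE)
  then have "AE z in disc_measure. norm (\<mu> z) \<le> C"
    by eventually_elim (use C order_trans in fastforce)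
  then show "\<exists>C. AE z in disc_measure. norm (\<mu> z) \<le> C" ..
next
  fix C :: real
  assume meas: "\<mu> \<in> borel_measurable disc_measure"
    and C: "AE z in disc_measure. norm (\<mu> z) \<le> C"
  have "Linf_norm \<mu> \<le> ereal C"
    unfolding Linf_norm_def using meas C by (intro esssup_I) auto
  then have "Linf_norm \<mu> < \<infinity>"
    by (rule le_less_trans) simp
  with meas show "\<mu> \<in> Linf" by (simp add: Linf_def)
qed

lemma Linf_diff:
  assumes "\<mu> \<in> Linf" "\<nu> \<in> Linf"
  shows "(\<lambda>z. \<mu> z - \<nu> z) \<in> Linf"
proof -
  from assms obtain C D :: real
    where C: "AE z in disc_measure. norm (\<mu> z) \<le> C" and D: "AE z in disc_measure. norm (\<nu> z) \<le> D"
    unfolding Linf_iff_bounded by blast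
  from C D have "AE z in disc_measure. norm (\<mu> z - \<nu> z) \<le> C + D"
    by eventually_elim (meson add_mono norm_triangle_ineq4 order_trans)
  with assms show ?thesis
    unfolding Linf_iff_bounded by (auto intro: borel_measurable_diff)
qed

lemma zero_in_Linf: "(\<lambda>_. 0) \<in> Linf"
  unfolding Linf_iff_bounded by (auto intro!: exI[of _ 0])

lemma integrable_Linf_mult:
  assumes "\<mu> \<in> Linf" "\<phi> \<in> A_disc"
  shows "integrable disc_measure (\<lambda>z. \<mu> z * \<phi> z)"
proof -
  from assms(1) obtain C :: real
    where meas: "\<mu> \<in> borel_measurable disc_measure" and C: "AE z in disc_measure. norm (\<mu> z) \<le> C"
    unfolding Linf_iff_bounded by blast
  have int: "integrable disc_measure \<phi>" using assms(2) by (simp add: A_disc_def)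
  show ?thesis
  proof (rule Bochner_Integration.integrable_bound)
    show "integrable disc_measure (\<lambda>z. of_real C * \<phi> z)" using int by simp
    show "(\<lambda>z. \<mu> z * \<phi> z) \<in> borel_measurable disc_measure"
      using meas int by (auto intro: borel_measurable_times)
    show "AE z in disc_measure. norm (\<mu> z * \<phi> z) \<le> norm (of_real C * \<phi> z)"
      using C by eventually_elim (auto simp: norm_mult intro!: mult_right_mono)
  qed
qed

lemma equiv_inf_equiv: "equiv Linf inf_equiv"
  by (rule equivI) (auto simp: inf_equiv_def refl_on_def sym_def trans_def)

lemma inf_equiv_iff_diff:
  "(\<mu>, \<nu>) \<in> inf_equiv \<longleftrightarrow> \<mu> \<in> Linf \<and> \<nu> \<in> Linf \<and> (\<lambda>z. \<mu> z - \<nu> z) \<in> N_disc"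
proof -
  have "(LINT z|disc_measure. (\<mu> z - \<nu> z) * \<phi> z) =
      (LINT z|disc_measure. \<mu> z * \<phi> z) - (LINT z|disc_measure. \<nu> z * \<phi> z)"
    if "\<mu> \<in> Linf" "\<nu> \<in> Linf" "\<phi> \<in> A_disc" for \<phi>
    using integrable_Linf_mult[OF that(1,3)] integrable_Linf_mult[OF that(2,3)]
    by (simp add: left_diff_distrib)
  then show ?thesis
    by (auto simp: N_disc_def inf_equiv_def Linf_diff zero_in_Linf)
qed

end

theory Submission
  imports Defs
begin

text \<open>
  The disc is cut by the lines \<^term>\<open>Re z = -1/2\<close> and \<^term>\<open>Re z = 1/2\<close> into a left part, a middle strip and
  a right part. The point of the construction is a sequence of entire functions \<open>p n\<close> with
    \<^item> \<open>p n\<close> tending to 1 uniformly on the left part and to 0 uniformly on the right part;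
    \<^item> on the strip, \<open>p n\<close> uniformly close to a fixed function \<open>F\<close> outside narrow gaps on which \<open>p n\<close>
      has little mass.

  Extend \<open>F\<close> by 1 to the left part, and let \<open>\<beta>\<close> be \<open>cnj F / norm F\<close> on the left part and the strip and 0 on
  the right part. Then the defects \<open>\<integral> norm (p n) - Re (\<beta> * p n)\<close> tend to 0, although the integrals of
  \<open>norm (p n)\<close> need not be bounded.

  Such a sequence exists by splicing (lemma \<open>splice_step\<close>): given \<open>p n\<close>, leave out two thin strips along the
  two lines, so thin that \<open>p n\<close> has little mass on them; on what remains of the disc the function that
  is 1 on the left, \<open>p n\<close> in the middle and 0 on the right is a uniform limit of entire functions.
  This instance of Runge's theorem reduces to approximating the step function of a half-plane off a thin strip,
  which is done by \<open>1 / (1 + exp (- N * z))\<close>; off the strip, this function is a uniform limit of entire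
  functions because its denominator can be deformed to the constant 2 without acquiring zeros
  (lemmas \<open>entire_approx_inverse_homotopy\<close> and \<open>entire_step_function\<close>).

  Put \<open>\<mu> = \<beta> / 2\<close>. If \<open>\<nu>\<close> is equivalent to \<open>\<mu>\<close> and bounded by 1/2, then the integrals of the nonnegative functions
  \<open>norm (p n) / 2 - Re (\<nu> * p n)\<close> are half the defects above and tend to 0; as \<open>p n\<close> tends to 1 on the left part,
  \<open>\<nu> = 1/2\<close> almost everywhere there (lemma \<open>hamilton_forces_direction\<close>). In particular \<open>\<mu>\<close> is extremal with norm 1/2.
  If an extremal \<open>\<nu>\<close> had Teichmueller form, its meromorphic function would be real on an
  open set, hence constant, and \<open>\<nu> = 1/2\<close> on the whole disc; but testing the equivalence against
  the constant function 1 excludes this, because \<open>Re \<mu>\<close> is at most 1/2 everywhere and 0 on the right part.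

  On the right part, on the other hand, nothing is forced: adding to \<open>\<mu>\<close> half of a nonzero function \<open>\<eta>\<close> that
  is bounded by 1, lives on a disc in the right part and annihilates all holomorphic functions gives
  a second extremal element. By the mean value property, such an \<open>\<eta>\<close> is the indicator function of a small ball minus the
  average of the indicator functions of its translates along a circle (lemma \<open>annihilator_exists\<close>).
\<close>

section \<open>Uniform approximation by entire functions\<close>

text \<open>
  A function on \<open>X\<close> that is a uniform limit on \<open>X\<close> of entire functions; its values
  outside \<open>X\<close> play no role.
\<close>

definition entire_approx :: "complex set \<Rightarrow> (complex \<Rightarrow> complex) \<Rightarrow> bool" where
  "entire_approx X f \<longleftrightarrow>
     (\<forall>e>0. \<exists>g. g holomorphic_on UNIV \<and> (\<forall>z\<in>X. norm (f z - g z) \<le> e))"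

lemma entire_approx_entire: "g holomorphic_on UNIV \<Longrightarrow> entire_approx X g"
  unfolding entire_approx_def by (auto intro!: exI[of _ g])

lemma entire_approx_add:
  assumes "entire_approx X f" "entire_approx X g"
  shows "entire_approx X (\<lambda>z. f z + g z)"
  unfolding entire_approx_def
proof (intro allI impI)
  fix e :: real assume "e > 0"
  then have "e / 2 > 0" by simp
  with assms obtain p q where p: "p holomorphic_on UNIV" "\<forall>z\<in>X. norm (f z - p z) \<le> e/2"
    and q: "q holomorphic_on UNIV" "\<forall>z\<in>X. norm (g z - q z) \<le> e/2"
    unfolding entire_approx_def by meson
  have "norm (f z + g z - (p z + q z)) \<le> e" if "z \<in> X" for z
  proof -
    have "norm ((f z - p z) + (g z - q z)) \<le> e/2 + e/2"
      using p q that by (intro norm_triangle_le add_mono) auto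
    then show ?thesis by (simp add: algebra_simps)
  qed
  then show "\<exists>h. h holomorphic_on UNIV \<and> (\<forall>z\<in>X. norm (f z + g z - h z) \<le> e)"
    using p q by (intro exI[of _ "\<lambda>z. p z + q z"]) (auto intro!: holomorphic_intros)
qed

lemma entire_approx_bounded:
  assumes "compact X" "entire_approx X f"
  obtains B where "B > 0" "\<And>z. z \<in> X \<Longrightarrow> norm (f z) \<le> B"
proof -
  obtain p where p: "p holomorphic_on UNIV" "\<forall>z\<in>X. norm (f z - p z) \<le> 1"
    using assms(2) unfolding entire_approx_def by (meson zero_less_one)
  have "compact (p ` X)"
    using assms(1) p(1) 
    by (meson compact_continuous_image continuous_on_subset holomorphic_on_imp_continuous_on subset_UNIV)
  then obtain B where B: "B > 0" "\<forall>z\<in>X. norm (p z) \<le> B"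
    using bounded_pos[of "p ` X"] compact_imp_bounded by auto
  show thesis
  proof (rule that[of "B + 1"])
    fix z assume "z \<in> X"
    then have "norm (f z - p z) \<le> 1" "norm (p z) \<le> B" using p B by auto
    then show "norm (f z) \<le> B + 1"
      using norm_triangle_sub[of "f z" "p z"] by linarith
  qed (use B in auto)
qed

lemma entire_approx_mult:
  assumes "compact X" "entire_approx X f" "entire_approx X g"
  shows "entire_approx X (\<lambda>z. f z * g z)"
  unfolding entire_approx_def
proof (intro allI impI)
  fix e :: real assume e: "e > 0"
  obtain A where A: "A > 0" "\<And>z. z \<in> X \<Longrightarrow> norm (f z) \<le> A"
    using entire_approx_bounded[OF assms(1,2)] by blast
  obtain B where B: "B > 0" "\<And>z. z \<in> X \<Longrightarrow> norm (g z) \<le> B"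
    using entire_approx_bounded[OF assms(1,3)] by blast
  define d where "d = min 1 (e / (A + B + 1))"
  have d: "d > 0" "d \<le> 1" "d * (A + B + 1) \<le> e"
  proof -
    have "d * (A + B + 1) \<le> e / (A + B + 1) * (A + B + 1)"
      using A(1) B(1) by (intro mult_right_mono) (auto simp: d_def)
    then show "d * (A + B + 1) \<le> e" using A(1) B(1) by simp
  qed (use e A(1) B(1) in \<open>auto simp: d_def\<close>)
  obtain p q where p: "p holomorphic_on UNIV" "\<forall>z\<in>X. norm (f z - p z) \<le> d"
    and q: "q holomorphic_on UNIV" "\<forall>z\<in>X. norm (g z - q z) \<le> d"
    using assms(2,3) d(1) unfolding entire_approx_def by meson
  have "norm (f z * g z - p z * q z) \<le> e" if z: "z \<in> X" for z
  proof -
    have "norm (q z) \<le> B + d"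
      using norm_triangle_sub[of "q z" "g z"] B(2)[OF z] q z by (fastforce simp: norm_minus_commute)
    then have "norm (f z * (g z - q z) + (f z - p z) * q z) \<le> A * d + d * (B + d)"
      using A z p q d by (intro norm_triangle_le add_mono) (auto simp: norm_mult intro!: mult_mono)
    also have "\<dots> \<le> d * (A + B + 1)"
      using d(1,2) by (simp add: algebra_simps)
    also note d(3)
    finally show ?thesis by (simp add: algebra_simps)
  qed
  then show "\<exists>h. h holomorphic_on UNIV \<and> (\<forall>z\<in>X. norm (f z * g z - h z) \<le> e)"
    using p q by (intro exI[of _ "\<lambda>z. p z * q z"]) (auto intro!: holomorphic_intros)
qed

lemma entire_approx_uniform_limit:
  assumes "\<And>e. e > 0 \<Longrightarrow> \<exists>g. entire_approx X g \<and> (\<forall>z\<in>X. norm (f z - g z) \<le> e)"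
  shows "entire_approx X f"
  unfolding entire_approx_def
proof (intro allI impI)
  fix e :: real assume "e > 0"
  then have "e / 2 > 0" by simp
  from assms[OF this] obtain g where g: "entire_approx X g" "\<forall>z\<in>X. norm (f z - g z) \<le> e/2"
    by blast
  with \<open>e / 2 > 0\<close> obtain p where p: "p holomorphic_on UNIV" "\<forall>z\<in>X. norm (g z - p z) \<le> e/2"
    unfolding entire_approx_def by meson
  have "norm (f z - p z) \<le> e" if "z \<in> X" for z
    using norm_triangle_le[of "f z - g z" "g z - p z" e] g(2) p(2) that by fastforce
  with p(1) show "\<exists>h. h holomorphic_on UNIV \<and> (\<forall>z\<in>X. norm (f z - h z) \<le> e)" by blast
qed

lemma entire_approx_power:
  "compact X \<Longrightarrow> entire_approx X f \<Longrightarrow> entire_approx X (\<lambda>z. f z ^ n)"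
  by (induction n) (auto intro: entire_approx_entire entire_approx_mult)

lemma entire_approx_sum:
  "(\<And>i. i < n \<Longrightarrow> entire_approx X (f i)) \<Longrightarrow> entire_approx X (\<lambda>z. \<Sum>i<(n::nat). f i z)"
  by (induction n) (auto intro: entire_approx_entire entire_approx_add)

text \<open>
  Reciprocals survive a relative perturbation by at most one half: with \<open>u = 1 - g / f\<close>,
  the reciprocal of \<open>g\<close> is \<open>1 / f\<close> times the geometric series in \<open>u\<close>.
\<close>

lemma entire_approx_inverse_perturb:
  assumes X: "compact X" and inv: "entire_approx X (\<lambda>z. 1 / f z)" 
    and f: "entire_approx X f" and g: "entire_approx X g"
    and nz: "\<And>z. z \<in> X \<Longrightarrow> f z \<noteq> 0"
    and close: "\<And>z. z \<in> X \<Longrightarrow> norm (f z - g z) \<le> norm (f z) / 2"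
  shows "entire_approx X (\<lambda>z. 1 / g z)"
proof (rule entire_approx_uniform_limit)
  fix e :: real assume e: "e > 0"
  define u where "u = (\<lambda>z. 1 + (-1) * (g z * (1 / f z)))"
  have u: "entire_approx X u"
    unfolding u_def
    by (intro entire_approx_add entire_approx_mult X inv g) (auto intro: entire_approx_entire)
  have norm_u: "norm (u z) \<le> 1/2" if "z \<in> X" for z
  proof -
    have "f z - g z = f z * u z" using nz[OF that] by (simp add: u_def field_simps)
    with close[OF that] have "norm (f z) * norm (u z) \<le> norm (f z) * (1/2)"
      by (simp add: norm_mult)
    moreover have "norm (f z) > 0" using nz[OF that] by simp
    ultimately show ?thesis by (simp only: mult_le_cancel_left_pos)
  qed
  obtain B where B: "B > 0" "\<And>z. z \<in> X \<Longrightarrow> norm (1 / f z) \<le> B"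
    using entire_approx_bounded[OF X inv] by blast
  obtain n where n: "(1/2) ^ n < e / (2 * B)"
    using real_arch_pow_inv[of "e / (2 * B)" "1/2"] e B by auto
  have "norm (1 / g z - 1 / f z * (\<Sum>i<n. u z ^ i)) \<le> e" if z: "z \<in> X" for z
  proof -
    have u1: "norm (1 - u z) \<ge> 1/2"
      using norm_triangle_ineq2[of 1 "u z"] norm_u[OF z] by simp
    then have "1 - u z \<noteq> 0" by auto
    moreover have gz: "g z = f z * (1 - u z)"
      using nz[OF z] by (simp add: u_def field_simps)
    ultimately have "1 / g z - 1 / f z * (\<Sum>i<n. u z ^ i) = 1 / f z * (u z ^ n / (1 - u z))"
      using nz[OF z] by (auto simp: sum_gp_strict field_simps)
    also have "norm \<dots> \<le> B * ((1/2) ^ n / (1/2))"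
      unfolding norm_mult norm_divide[of "u z ^ n"] norm_power
      using B z u1 norm_u[OF z] by (intro mult_mono frac_le power_mono) auto
    also have "\<dots> \<le> e"
      using n B(1) by (simp add: field_simps)
    finally show ?thesis .
  qed
  moreover have "entire_approx X (\<lambda>z. 1 / f z * (\<Sum>i<n. u z ^ i))"
    using X inv u by (intro entire_approx_mult entire_approx_sum entire_approx_power)
  ultimately show "\<exists>h. entire_approx X h \<and> (\<forall>z\<in>X. norm (1 / g z - h z) \<le> e)"
    by blast
qed

text \<open>
  Along a homotopy of entire functions without zeros on the compact set \<open>X\<close>, the
  property that the reciprocal is entire-approximable on \<open>X\<close> propagates in finitely many
  perturbation steps. This replaces the pushing of poles in the usual proof of Runge's
  theorem.
\<close>

lemma entire_approx_inverse_homotopy: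
  fixes G :: "real \<Rightarrow> complex \<Rightarrow> complex"
  assumes X: "compact X"
    and cont: "continuous_on ({0..1} \<times> X) (\<lambda>(s, z). G s z)"
    and hol: "\<And>s. s \<in> {0..1} \<Longrightarrow> (G s) holomorphic_on UNIV"
    and nz: "\<And>s z. s \<in> {0..1} \<Longrightarrow> z \<in> X \<Longrightarrow> G s z \<noteq> 0"
    and base: "entire_approx X (\<lambda>z. 1 / G 0 z)"
  shows "entire_approx X (\<lambda>z. 1 / G 1 z)"
proof (cases "X = {}")
  case True
  then show ?thesis using base by (simp add: entire_approx_def)
next
  case False
  let ?K = "{0..1::real} \<times> X"
  have K: "compact ?K" using X by (intro compact_Times) auto
  have "continuous_on ?K (\<lambda>p. norm (case p of (s, z) \<Rightarrow> G s z))"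
    using cont by (rule continuous_on_norm)
  with continuous_attains_inf[OF K, of "\<lambda>p. norm (case p of (s, z) \<Rightarrow> G s z)"] False
  obtain s0 z0 where s0: "s0 \<in> {0..1}" "z0 \<in> X"
    "\<And>s z. s \<in> {0..1} \<Longrightarrow> z \<in> X \<Longrightarrow> norm (G s0 z0) \<le> norm (G s z)"
    by (auto simp: Ball_def) (metis atLeastAtMost_iff)
  define m where "m = norm (G s0 z0)"
  have m: "m > 0" using nz s0 by (simp add: m_def)
  have "uniformly_continuous_on ?K (\<lambda>(s, z). G s z)"
    using cont K by (rule compact_uniformly_continuous)
  then obtain t where t: "t > 0"
    "\<And>p q. p \<in> ?K \<Longrightarrow> q \<in> ?K \<Longrightarrow> dist q p < t \<Longrightarrow>
       dist (case q of (s, z) \<Rightarrow> G s z) (case p of (s, z) \<Rightarrow> G s z) < m / 2"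
    using m unfolding uniformly_continuous_on_def by (metis half_gt_zero)
  obtain n :: nat where n: "1 / t < n" "n > 0"
    using reals_Archimedean2[of "max 1 (1 / t)"] by (metis max_less_iff_conj of_nat_0_less_iff zero_less_one less_trans)
  have step: "norm (G s z - G s' z) \<le> norm (G s z) / 2"
    if "s \<in> {0..1}" "s' \<in> {0..1}" "\<bar>s - s'\<bar> < t" "z \<in> X" for s s' z
  proof -
    have "dist (G s z) (G s' z) < m / 2"
      using t(2)[of "(s', z)" "(s, z)"] that by (simp add: dist_Pair_Pair dist_real_def)
    then show ?thesis
      using s0(3)[of s z] that unfolding dist_norm m_def by linarith
  qed
  have "entire_approx X (\<lambda>z. 1 / G (real j / real n) z)" if "j \<le> n" for j
    using that
  proof (induction j)
    case 0
    then show ?case using base by simp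
  next
    case (Suc j)
    have in01: "real j / n \<in> {0..1}" "real (Suc j) / n \<in> {0..1}"
      using Suc.prems n by (auto simp: field_simps)
    have "real j / n - real (Suc j) / n = - 1 / n"
      using n(2) by (simp add: field_simps)
    then have "\<bar>real j / n - real (Suc j) / n\<bar> < t"
      using n t(1) by (simp add: field_simps)
    with in01 Suc X hol nz step show ?case
      by (intro entire_approx_inverse_perturb[where f = "G (real j / n)" and g = "G (real (Suc j) / n)"])
         (auto intro!: entire_approx_entire)
  qed
  from this[of n] n show ?thesis by simp
qed

text \<open>
  The function \<open>1 / (1 + exp (- N * (z - c)))\<close> is close to 0 to the left and close to 1
  to the right of the strip around \<open>Re z = c\<close>. Replacing \<open>N\<close> by \<open>s * N\<close> with \<open>s\<close> from 0
  to 1 deforms its denominator from the constant 2; zeros occur only on the line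
  \<open>Re z = c\<close>, at a positive distance from the set under consideration.
\<close>

lemma entire_step_function:
  fixes a b R e :: real
  assumes ab: "a < b" and e: "e > 0"
  obtains h where "h holomorphic_on UNIV"
    "\<And>z. norm z \<le> R \<Longrightarrow> Re z \<le> a \<Longrightarrow> norm (h z) \<le> e"
    "\<And>z. norm z \<le> R \<Longrightarrow> Re z \<ge> b \<Longrightarrow> norm (h z - 1) \<le> e"
proof -
  define X where "X = cball 0 R \<inter> ({z. Re z \<le> a} \<union> {z. Re z \<ge> b})"
  define c d where "c = (a + b) / 2" and "d = (b - a) / 2"
  have d: "d > 0" using ab by (simp add: d_def)
  obtain N :: real where N: "N > 0" "exp (- (N * d)) \<le> min (1/2) (e / 4)"
  proof
    let ?m = "min (1/2) (e / 4)"
    have m: "0 < ?m" "?m < 1" using e by auto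
    show "- ln ?m / d > 0" using m d ln_less_zero[of ?m] by (intro divide_pos_pos) auto
    show "exp (- (- ln ?m / d * d)) \<le> ?m" using m d by simp
  qed
  define q where "q = exp (- (N * d))"
  have q: "q \<le> 1/2" "q \<le> e / 4" "q > 0" using N by (auto simp: q_def)
  define G where "G = (\<lambda>(s::real) (z::complex). 1 + exp (- (of_real (s * N) * (z - of_real c))))"
  have "closed ({z. Re z \<le> a} \<union> {z. Re z \<ge> b})"
    by (intro closed_Un closed_halfspace_Re_le closed_halfspace_Re_ge)
  then have X: "compact X" unfolding X_def by (intro compact_Int_closed) auto
  have side: "Re z - c \<le> - d \<or> Re z - c \<ge> d" if "z \<in> X" for z
    using that by (auto simp: X_def c_def d_def field_simps)
  have "entire_approx X (\<lambda>z. 1 / G 1 z)"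
  proof (rule entire_approx_inverse_homotopy[OF X])
    show "continuous_on ({0..1} \<times> X) (\<lambda>(s, z). G s z)"
      unfolding G_def case_prod_unfold by (intro continuous_intros)
    show "G s holomorphic_on UNIV" for s
      unfolding G_def by (intro holomorphic_intros)
    show "entire_approx X (\<lambda>z. 1 / G 0 z)"
      by (intro entire_approx_entire) (simp add: G_def)
    show "G s z \<noteq> 0" if s: "s \<in> {0..1}" and z: "z \<in> X" for s z
    proof
      assume "G s z = 0"
      then have "exp (- (of_real (s * N) * (z - of_real c))) = - 1"
        by (simp add: G_def add_eq_0_iff)
      then have "norm (exp (- (of_real (s * N) * (z - of_real c)))) = 1" and "s \<noteq> 0" by auto
      then have "s * N * (Re z - c) = 0" by (simp add: norm_exp_eq_Re)
      with \<open>s \<noteq> 0\<close> N side[OF z] d show False by auto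
    qed
  qed
  then obtain h where h: "h holomorphic_on UNIV" "\<And>z. z \<in> X \<Longrightarrow> norm (1 / G 1 z - h z) \<le> e / 2"
    using e unfolding entire_approx_def by (metis half_gt_zero)
  have ne: "norm (exp (- (of_real N * (z - of_real c)))) = exp (- (N * (Re z - c)))" for z
    by (simp add: norm_exp_eq_Re)
  show thesis
  proof (rule that[OF h(1)])
    fix z :: complex assume z: "norm z \<le> R" "Re z \<le> a"
    define w where "w = exp (- (of_real N * (z - of_real c)))"
    have "Re z - c \<le> - d" using z by (simp add: c_def d_def field_simps)
    then have "exp (N * d) \<le> norm w"
      unfolding w_def ne using mult_left_mono[of "Re z - c" "- d" N] N(1) by simp
    moreover have "exp (N * d) = 1 / q" by (simp add: q_def exp_minus field_simps)
    ultimately have "1 / q \<le> norm w" by simp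
    moreover have "1 / q \<ge> 2" using q by (simp add: field_simps)
    moreover have "norm w - 1 \<le> norm (1 + w)" 
      using norm_triangle_ineq2[of w "-1"] by (simp add: add.commute)
    ultimately have "1 / (2 * q) \<le> norm (1 + w)" by (simp add: field_simps)
    moreover have "1 / (2 * q) > 0" using q by simp
    ultimately have "norm (1 / (1 + w)) \<le> 1 / (1 / (2 * q))"
      unfolding norm_divide norm_one by (intro frac_le) auto
    then have "norm (1 / (1 + w)) \<le> e / 2" using q by simp
    moreover have "norm (1 / (1 + w) - h z) \<le> e / 2"
      using h(2)[of z] z by (simp add: X_def G_def w_def)
    ultimately show "norm (h z) \<le> e"
      using norm_triangle_sub[of "h z" "1 / (1 + w)"] by (simp add: norm_minus_commute)
  next
    fix z :: complex assume z: "norm z \<le> R" "Re z \<ge> b"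
    define w where "w = exp (- (of_real N * (z - of_real c)))"
    have "Re z - c \<ge> d" using z by (simp add: c_def d_def field_simps)
    then have w: "norm w \<le> q"
      unfolding w_def ne q_def using mult_left_mono[of d "Re z - c" N] N(1) by simp
    have n1: "norm (1 + w) \<ge> 1/2"
      using norm_triangle_ineq2[of 1 "-w"] w q by simp
    then have "1 + w \<noteq> 0" by auto
    then have "1 / (1 + w) - 1 = - w / (1 + w)" by (simp add: field_simps)
    also have "norm \<dots> \<le> q / (1/2)"
      unfolding norm_divide using n1 w q by (intro frac_le) auto
    also have "\<dots> \<le> e / 2" using q by simp
    finally have "norm (1 / (1 + w) - 1) \<le> e / 2" .
    moreover have "norm (1 / (1 + w) - h z) \<le> e / 2"
      using h(2)[of z] z by (simp add: X_def G_def w_def)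
    ultimately have "norm ((1 / (1 + w) - 1) - (1 / (1 + w) - h z)) \<le> e / 2 + e / 2"
      by (rule order_trans[OF norm_triangle_ineq4 add_mono])
    then show "norm (h z - 1) \<le> e" by simp
  qed
qed

section \<open>Integrals and null sets on the disc\<close>

lemma finite_measure_disc: "finite_measure disc_measure"
  by (intro finite_measure_lebesgue_on lmeasurable_ball)

lemma integrable_disc_continuous:
  fixes f :: "complex \<Rightarrow> 'b::euclidean_space"
  assumes "continuous_on (cball 0 1) f"
  shows "integrable disc_measure f"
proof -
  interpret finite_measure disc_measure by (rule finite_measure_disc)
  have "bounded (f ` cball 0 1)"
    using assms by (intro compact_imp_bounded compact_continuous_image) auto
  then obtain M where "\<And>z. norm z \<le> 1 \<Longrightarrow> norm (f z) \<le> M"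
    unfolding bounded_iff by (metis imageI mem_cball_0)
  moreover have "f \<in> borel_measurable disc_measure"
    using assms by (intro continuous_imp_measurable_on_sets_lebesgue)
      (auto intro: continuous_on_subset)
  ultimately show ?thesis
    by (intro integrable_const_bound[where B = M]) (auto simp: space_restrict_space)
qed

lemma A_disc_entire:
  assumes "p holomorphic_on UNIV"
  shows "p \<in> A_disc"
proof -
  have "p holomorphic_on S" for S using assms by (rule holomorphic_on_subset) simp
  then show ?thesis
    by (simp add: A_disc_def integrable_disc_continuous holomorphic_on_imp_continuous_on)
qed

lemma AE_disc_open_witness:
  assumes "AE z in disc_measure. P z" "open V" "V \<subseteq> disc" "V \<noteq> {}"
  obtains z where "z \<in> V" "P z"
proof -
  have "AE z in lebesgue. z \<in> disc \<longrightarrow> P z"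
    using assms(1) by (subst (asm) AE_restrict_space_iff) auto
  then obtain N where N: "N \<in> null_sets lebesgue" "{z. \<not> (z \<in> disc \<longrightarrow> P z)} \<subseteq> N"
    by (auto elim!: eventually_ae_filter[THEN iffD1, THEN bexE] simp: eventually_ae_filter)
  have "\<not> V \<subseteq> N"
  proof
    assume "V \<subseteq> N"
    then have "negligible V"
      using N(1) negligible_iff_null_sets negligible_subset by blast
    with assms open_not_negligible show False by blast
  qed
  then show thesis using that N(2) assms(3) by blast
qed

lemma AE_disc_cosparse:
  assumes "eventually P (cosparse disc)"
  shows "AE z in disc_measure. P z"
proof -
  have "countable (disc \<inter> {z. \<not> P z})"
    using assms by (intro sparse_imp_countable) (auto simp: eventually_cosparse)
  then have "disc \<inter> {z. \<not> P z} \<in> null_sets lebesgue"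
    by (intro null_sets_completionI countable_imp_null_set_lborel)
  then have "AE z in lebesgue. z \<in> disc \<longrightarrow> P z"
    by (intro AE_I'[of "disc \<inter> {z. \<not> P z}"]) auto
  then show ?thesis by (subst AE_restrict_space_iff) auto
qed

lemma Linf_norm_le_iff:
  assumes "\<mu> \<in> borel_measurable disc_measure"
  shows "Linf_norm \<mu> \<le> ereal c \<longleftrightarrow> (AE z in disc_measure. norm (\<mu> z) \<le> c)"
proof
  assume le: "Linf_norm \<mu> \<le> ereal c"
  have "AE z in disc_measure. ereal (norm (\<mu> z)) \<le> Linf_norm \<mu>"
    unfolding Linf_norm_def by (rule esssup_AE)
  then show "AE z in disc_measure. norm (\<mu> z) \<le> c"
    by eventually_elim (use le order_trans in fastforce)
next
  assume "AE z in disc_measure. norm (\<mu> z) \<le> c"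
  then show "Linf_norm \<mu> \<le> ereal c"
    unfolding Linf_norm_def using assms by (intro esssup_I) auto
qed

section \<open>Splicing constants and an entire function\<close>

text \<open>
  For \<open>d\<close> at most 1, the two strips of width \<open>d\<close>, inside the middle part of the disc and adjacent to the
  lines \<open>Re z = -1/2\<close> and \<open>Re z = 1/2\<close>, on which an approximating function remains
  uncontrolled.
\<close>

definition gap :: "real \<Rightarrow> complex set" where
  "gap d = {z\<in>disc. - 1/2 < Re z \<and> Re z < - 1/2 + d \<or> 1/2 - d < Re z \<and> Re z < 1/2}"

lemma gap_measurable: "gap t \<in> sets disc_measure"
proof -
  have "gap t = disc \<inter> ({z. Re z > - 1/2} \<inter> {z. Re z < - 1/2 + t} \<union>
      {z. Re z > 1/2 - t} \<inter> {z. Re z < 1/2})"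
    by (auto simp: gap_def)
  moreover have "open \<dots>"
    by (intro open_Int open_Un open_ball open_halfspace_Re_lt open_halfspace_Re_gt)
  ultimately have "open (gap t)" by (simp only:)
  then show ?thesis by (auto simp: sets_restrict_space_iff gap_def)
qed

text \<open>
  The gaps decrease to the empty set, so that dominated convergence applies.
\<close>

lemma gap_mass_small:
  assumes p: "p holomorphic_on UNIV" and e: "e > 0" and d: "d > 0"
  obtains d' where "0 < d'" "d' \<le> d" "(LINT z|disc_measure. norm (p z) * indicator (gap d') z) \<le> e"
proof -
  define s where "s = (\<lambda>n. d / real (Suc n))"
  have s: "s n > 0" "s n \<le> d" for n using d by (auto simp: s_def field_simps)
  have s0: "s \<longlonglongrightarrow> 0" unfolding s_def
    using LIMSEQ_Suc[OF lim_const_over_n[of d]] by simp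
  have cont: "continuous_on UNIV p" using p by (rule holomorphic_on_imp_continuous_on)
  have int: "integrable disc_measure (\<lambda>z. norm (p z))"
    using cont by (intro integrable_disc_continuous continuous_intros) (auto intro: continuous_on_subset)
  have "(\<lambda>n. LINT z|disc_measure. norm (p z) * indicator (gap (s n)) z) \<longlonglongrightarrow> (LINT z|disc_measure. 0)"
  proof (rule integral_dominated_convergence[where w = "\<lambda>z. norm (p z)"])
    show "(\<lambda>z. norm (p z) * indicator (gap (s n)) z) \<in> borel_measurable disc_measure" for n
      using int gap_measurable[of "s n"] by (intro borel_measurable_times) (auto)
    show "AE z in disc_measure. (\<lambda>n. norm (p z) * indicator (gap (s n)) z) \<longlonglongrightarrow> 0"
    proof (rule AE_I2)
      fix z :: complex
      have "eventually (\<lambda>n. z \<notin> gap (s n)) sequentially"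
      proof -
        define t where "t = min (if - 1/2 < Re z then Re z + 1/2 else 1) (if Re z < 1/2 then 1/2 - Re z else 1)"
        have "t > 0" by (auto simp: t_def)
        with s0 have "eventually (\<lambda>n. s n < t) sequentially" by (rule order_tendstoD)
        then show ?thesis
          by eventually_elim (auto simp: gap_def t_def split: if_splits)
      qed
      then show "(\<lambda>n. norm (p z) * indicator (gap (s n)) z) \<longlonglongrightarrow> 0"
        by (intro tendsto_eventually, elim eventually_mono) simp
    qed
    show "AE z in disc_measure. norm (norm (p z) * indicator (gap (s n)) z) \<le> norm (p z)" for n
      by (auto simp: indicator_def)
  qed (use int in auto)
  then have "eventually (\<lambda>n. (LINT z|disc_measure. norm (p z) * indicator (gap (s n)) z) < e) sequentially"
    using e by (intro order_tendstoD) auto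
  then obtain n where "(LINT z|disc_measure. norm (p z) * indicator (gap (s n)) z) < e"
    by (meson eventually_sequentially order_refl)
  with s show thesis by (intro that[of "s n"]) auto
qed

text \<open>
  An entire function close to 1 on the left, to \<open>p\<close> on the middle part outside the gaps,
  and to 0 on the right, by means of the two step functions along the separating lines.
\<close>

lemma splice_step:
  assumes p: "p holomorphic_on UNIV" and e: "e > 0" and d: "d > 0"
  obtains q where "q holomorphic_on UNIV"
    "\<And>z. z \<in> disc \<Longrightarrow> Re z \<le> - 1/2 \<Longrightarrow> norm (q z - 1) \<le> e"
    "\<And>z. z \<in> disc \<Longrightarrow> Re z \<ge> 1/2 \<Longrightarrow> norm (q z) \<le> e"
    "\<And>z. z \<in> disc \<Longrightarrow> - 1/2 + d \<le> Re z \<Longrightarrow> Re z \<le> 1/2 - d \<Longrightarrow> norm (q z - p z) \<le> e"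
proof -
  have "continuous_on (cball 0 1) p"
    using p by (meson continuous_on_subset holomorphic_on_imp_continuous_on subset_UNIV)
  then have "bounded (p ` cball 0 1)"
    by (intro compact_imp_bounded compact_continuous_image) auto
  then obtain M where M: "M > 0" "\<And>z. norm z \<le> 1 \<Longrightarrow> norm (p z) \<le> M"
    unfolding bounded_pos by auto
  define t where "t = min 1 (e / (2 + 4 * M))"
  have t: "t > 0" "t \<le> 1" using M(1) e by (auto simp: t_def intro!: divide_pos_pos)
  have te: "t * (2 + 4 * M) \<le> e"
  proof -
    have "t * (2 + 4 * M) \<le> e / (2 + 4 * M) * (2 + 4 * M)"
      using M(1) by (intro mult_right_mono) (auto simp: t_def)
    then show ?thesis using M(1) by simp
  qed
  obtain h1 where h1: "h1 holomorphic_on UNIV"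
    "\<And>z. norm z \<le> 1 \<Longrightarrow> Re z \<le> - 1/2 \<Longrightarrow> norm (h1 z) \<le> t"
    "\<And>z. norm z \<le> 1 \<Longrightarrow> Re z \<ge> - 1/2 + min d 1 \<Longrightarrow> norm (h1 z - 1) \<le> t"
    using entire_step_function[of "- 1/2" "- 1/2 + min d 1" t 1] d t(1) by auto
  obtain h2 where h2: "h2 holomorphic_on UNIV"
    "\<And>z. norm z \<le> 1 \<Longrightarrow> Re z \<le> 1/2 - min d 1 \<Longrightarrow> norm (h2 z) \<le> t"
    "\<And>z. norm z \<le> 1 \<Longrightarrow> Re z \<ge> 1/2 \<Longrightarrow> norm (h2 z - 1) \<le> t"
    using entire_step_function[of "1/2 - min d 1" "1/2" t 1] d t(1) by auto
  define q where "q = (\<lambda>z. 1 + h1 z * ((1 - h2 z) * p z - 1))"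
  show thesis
  proof (rule that[of q])
    show "q holomorphic_on UNIV" unfolding q_def using p h1(1) h2(1) by (intro holomorphic_intros)
  next
    fix z assume z: "z \<in> disc" "Re z \<le> - 1/2"
    then have nz: "norm z \<le> 1" "Re z \<le> 1/2 - min d 1" using d by auto
    have "norm (1 - h2 z) \<le> 1 + t" using h2(2)[OF nz] by (intro norm_triangle_le_diff) auto
    then have "norm ((1 - h2 z) * p z - 1) \<le> (1 + t) * M + 1"
      using M(2)[OF nz(1)] t M(1) by (intro norm_triangle_le_diff add_mono) (auto simp: norm_mult intro!: mult_mono)
    then have "norm (q z - 1) \<le> t * ((1 + t) * M + 1)"
      using h1(2)[OF nz(1) z(2)] t by (auto simp: q_def norm_mult intro!: mult_mono)
    also have "\<dots> \<le> t * ((1 + 1) * M + 1)"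
      using t M(1) by (intro mult_left_mono add_mono mult_right_mono) auto
    also have "\<dots> \<le> t * (2 + 4 * M)"
      using t M(1) by (intro mult_left_mono) auto
    also note te
    finally show "norm (q z - 1) \<le> e" .
  next
    fix z assume z: "z \<in> disc" "Re z \<ge> 1/2"
    then have nz: "norm z \<le> 1" "Re z \<ge> - 1/2 + min d 1" by auto
    have "norm (1 + (h1 z - 1)) \<le> 1 + t" using h1(3)[OF nz] by (intro norm_triangle_le) auto
    then have n1: "norm (h1 z) \<le> 1 + 1" using t by simp
    have "q z = - (h1 z - 1) + h1 z * (- (h2 z - 1)) * p z" by (simp add: q_def algebra_simps)
    also have "norm \<dots> \<le> t + (1 + 1) * t * M"
      using h1(3)[OF nz] n1 h2(3)[OF nz(1) z(2)] M(2)[OF nz(1)] t M(1)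
      by (intro norm_triangle_le add_mono) (auto simp: norm_mult norm_minus_commute intro!: mult_mono)
    also have "\<dots> \<le> t * (2 + 4 * M)"
      using t M(1) by (simp add: algebra_simps)
    also note te
    finally show "norm (q z) \<le> e" .
  next
    fix z assume z: "z \<in> disc" "- 1/2 + d \<le> Re z" "Re z \<le> 1/2 - d"
    then have nz: "norm z \<le> 1" "Re z \<ge> - 1/2 + min d 1" "Re z \<le> 1/2 - min d 1" by auto
    have "norm (1 + (h1 z - 1)) \<le> 1 + t" using h1(3)[OF nz(1,2)] by (intro norm_triangle_le) auto
    then have n1: "norm (h1 z) \<le> 1 + 1" using t by simp
    have n2: "norm ((h1 z - 1) - h1 z * h2 z) \<le> t + (1 + 1) * t"
    proof (rule order_trans[OF norm_triangle_ineq4], rule add_mono)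
      show "norm (h1 z * h2 z) \<le> (1 + 1) * t"
        unfolding norm_mult using n1 h2(2)[OF nz(1,3)] t by (intro mult_mono) auto
    qed (rule h1(3)[OF nz(1,2)])
    have "q z - p z = - (h1 z - 1) + ((h1 z - 1) - h1 z * h2 z) * p z"
      by (simp add: q_def algebra_simps)
    also have "norm \<dots> \<le> t + (t + (1 + 1) * t) * M"
      using h1(3)[OF nz(1,2)] n2 M(2)[OF nz(1)] t M(1)
      by (intro norm_triangle_le add_mono) (auto simp: norm_mult norm_minus_commute intro!: mult_mono)
    also have "\<dots> \<le> t * (2 + 4 * M)"
      using t M(1) by (simp add: algebra_simps)
    also note te
    finally show "norm (q z - p z) \<le> e" .
  qed
qed

text \<open>
  The gap of index \<open>Suc n\<close> is chosen after \<open>p n\<close>, so that \<open>p n\<close> has small mass on it,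
  and before \<open>p (Suc n)\<close>, which may be large on it.
\<close>

lemma splice_sequence:
  obtains p :: "nat \<Rightarrow> complex \<Rightarrow> complex" and d :: "nat \<Rightarrow> real" where
    "\<And>n. p n holomorphic_on UNIV" "\<And>n. d n > 0" "\<And>n. d (Suc n) \<le> d n"
    "\<And>n. (LINT z|disc_measure. norm (p n z) * indicator (gap (d (Suc n))) z) \<le> (1/2) ^ n"
    "\<And>n z. z \<in> disc \<Longrightarrow> Re z \<le> - 1/2 \<Longrightarrow> norm (p n z - 1) \<le> (1/2) ^ n"
    "\<And>n z. z \<in> disc \<Longrightarrow> Re z \<ge> 1/2 \<Longrightarrow> norm (p n z) \<le> (1/2) ^ n"
    "\<And>n z. z \<in> disc \<Longrightarrow> - 1/2 + d (Suc n) \<le> Re z \<Longrightarrow> Re z \<le> 1/2 - d (Suc n) \<Longrightarrow>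
       norm (p (Suc n) z - p n z) \<le> (1/2) ^ n"
proof -
  define P where "P = (\<lambda>n (p :: complex \<Rightarrow> complex, d::real). p holomorphic_on UNIV \<and> d > 0 \<and>
     (\<forall>z\<in>disc. Re z \<le> - 1/2 \<longrightarrow> norm (p z - 1) \<le> (1/2) ^ n) \<and>
     (\<forall>z\<in>disc. Re z \<ge> 1/2 \<longrightarrow> norm (p z) \<le> (1/2) ^ n))"
  define Q where "Q = (\<lambda>n (p :: complex \<Rightarrow> complex, d) (q :: complex \<Rightarrow> complex, d'). d' \<le> d \<and>
     (LINT z|disc_measure. norm (p z) * indicator (gap d') z) \<le> (1/2) ^ n \<and>
     (\<forall>z\<in>disc. - 1/2 + d' \<le> Re z \<longrightarrow> Re z \<le> 1/2 - d' \<longrightarrow> norm (q z - p z) \<le> (1/2::real) ^ n))"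
  have "\<exists>f. \<forall>n. P n (f n) \<and> Q n (f n) (f (Suc n))"
  proof (rule dependent_nat_choice)
    obtain q where "q holomorphic_on UNIV"
      "\<And>z. z \<in> disc \<Longrightarrow> Re z \<le> - 1/2 \<Longrightarrow> norm (q z - 1) \<le> 1"
      "\<And>z. z \<in> disc \<Longrightarrow> Re z \<ge> 1/2 \<Longrightarrow> norm (q z) \<le> 1"
      using splice_step[of "\<lambda>_. 0" 1 1] by auto
    then have "P 0 (q, 1)" by (auto simp: P_def)
    then show "\<exists>x. P 0 x" ..
  next
    fix x n assume "P n x"
    then obtain p d where x: "x = (p, d)" and p: "p holomorphic_on UNIV" and d: "d > 0"
      by (auto simp: P_def)
    obtain d' where d': "0 < d'" "d' \<le> d"
      "(LINT z|disc_measure. norm (p z) * indicator (gap d') z) \<le> (1/2) ^ n"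
      using gap_mass_small[OF p _ d, of "(1/2) ^ n"] by auto
    obtain q where "q holomorphic_on UNIV"
      "\<And>z. z \<in> disc \<Longrightarrow> Re z \<le> - 1/2 \<Longrightarrow> norm (q z - 1) \<le> (1/2) ^ Suc n"
      "\<And>z. z \<in> disc \<Longrightarrow> Re z \<ge> 1/2 \<Longrightarrow> norm (q z) \<le> (1/2) ^ Suc n"
      and q: "\<And>z. z \<in> disc \<Longrightarrow> - 1/2 + d' \<le> Re z \<Longrightarrow> Re z \<le> 1/2 - d' \<Longrightarrow>
        norm (q z - p z) \<le> (1/2) ^ Suc n"
      using splice_step[OF p _ d'(1), of "(1/2) ^ Suc n"] by (metis half_gt_zero zero_less_one zero_less_power)
    then have "P (Suc n) (q, d')" using d' by (auto simp: P_def)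
    moreover have "norm (q z - p z) \<le> (1/2) ^ n"
      if "z \<in> disc" "- 1/2 + d' \<le> Re z" "Re z \<le> 1/2 - d'" for z
    proof -
      have "(1/2::real) ^ Suc n \<le> (1/2) ^ n" by simp
      then show ?thesis using q[OF that] by (rule order_trans[rotated])
    qed
    ultimately show "\<exists>y. P (Suc n) y \<and> Q n x y"
      using d' by (intro exI[of _ "(q, d')"]) (auto simp: Q_def x)
  qed
  then obtain f where f: "\<And>n. P n (f n)" "\<And>n. Q n (f n) (f (Suc n))" by blast
  show thesis
  proof (rule that[of "\<lambda>n. fst (f n)" "\<lambda>n. snd (f n)"])
  qed (use f in \<open>auto simp: P_def Q_def case_prod_unfold\<close>)
qed

section \<open>The limiting direction\<close>

lemma geometric_increments_limit:
  fixes a :: "nat \<Rightarrow> complex"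
  assumes "\<And>m. m \<ge> n \<Longrightarrow> norm (a (Suc m) - a m) \<le> (1/2) ^ m"
  shows "convergent a" "norm (a n - lim a) \<le> 2 * (1/2) ^ n"
proof -
  have tail: "norm (a (m + j) - a m) \<le> 2 * (1/2) ^ m" if "m \<ge> n" for m j
  proof -
    have "norm (a (m + j) - a m) \<le> 2 * (1/2) ^ m * (1 - (1/2) ^ j)"
    proof (induction j)
      case (Suc j)
      have "norm (a (Suc (m + j)) - a (m + j) + (a (m + j) - a m)) \<le>
          (1/2) ^ (m + j) + 2 * (1/2) ^ m * (1 - (1/2) ^ j)"
        using assms[of "m + j"] that Suc by (intro norm_triangle_le add_mono) auto
      then show ?case by (simp add: power_add algebra_simps)
    qed simp
    also have "\<dots> \<le> 2 * (1/2) ^ m * 1" by (intro mult_left_mono) auto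
    finally show ?thesis by simp
  qed
  show conv: "convergent a"
  proof (rule Cauchy_convergent, rule CauchyI')
    fix e :: real assume "e > 0"
    then obtain M where M: "(1/2::real) ^ M < e / 2"
      using real_arch_pow_inv[of "e/2" "1/2"] by auto
    have "dist (a m) (a l) < e" if "m \<ge> max n M" "l > m" for m l
    proof -
      have "norm (a m - a l) \<le> 2 * (1/2) ^ m"
        using tail[of m "l - m"] that by (simp add: norm_minus_commute)
      also have "\<dots> \<le> 2 * (1/2) ^ M"
        using that by (intro mult_left_mono power_decreasing) auto
      finally show ?thesis using M by (simp add: dist_norm)
    qed
    then show "\<exists>M. \<forall>m\<ge>M. \<forall>l>m. dist (a m) (a l) < e" by blast
  qed
  then have "(\<lambda>j. a (j + n)) \<longlonglongrightarrow> lim a"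
    by (intro LIMSEQ_ignore_initial_segment) (simp add: convergent_LIMSEQ_iff)
  then have "(\<lambda>j. norm (a n - a (j + n))) \<longlonglongrightarrow> norm (a n - lim a)"
    by (intro tendsto_intros)
  then show "norm (a n - lim a) \<le> 2 * (1/2) ^ n"
    using tail[of n] by (intro LIMSEQ_le_const2) (auto simp: add.commute norm_minus_commute)
qed

text \<open>
  The factor in front of \<open>p\<close> rotates \<open>F\<close> to its modulus; for \<open>F = 0\<close> it is 0 by the
  convention on division, and the estimate still holds.
\<close>

lemma polar_defect_le:
  fixes p F :: complex
  shows "norm p - Re (cnj F / of_real (norm F) * p) \<le> 2 * norm (p - F)"
proof (cases "F = 0")
  case False
  let ?b = "cnj F / of_real (norm F)"
  have nb: "norm ?b = 1" using False by (simp add: norm_divide)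
  have "?b * F = of_real (norm F)"
    using False by (simp add: complex_norm_square[symmetric] field_simps power2_eq_square mult.commute)
  then have "?b * p = of_real (norm F) + ?b * (p - F)"
    by (simp only: right_diff_distrib) simp
  then have "Re (?b * p) = norm F + Re (?b * (p - F))"
    by (simp only: plus_complex.sel Re_complex_of_real)
  moreover have "\<bar>Re (?b * (p - F))\<bar> \<le> norm (?b * (p - F))"
    by (rule abs_Re_le_cmod)
  moreover have "norm (?b * (p - F)) = norm (p - F)" by (simp only: norm_mult nb mult_1)
  moreover have "norm p \<le> norm F + norm (p - F)" using norm_triangle_sub by blast
  ultimately show ?thesis by linarith
qed auto

text \<open>
  The spliced sequence converges on the left part and, as the gaps decrease, at every
  point of the strip outside one of the gaps; \<open>\<beta>\<close> is the conjugate direction of its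
  limit \<open>F\<close>. What \<open>F\<close> is at a point inside all gaps does not matter, because \<open>p n\<close> has
  mass at most \<open>(1/2) ^ n\<close> on the gap of index \<open>Suc n\<close>.
\<close>

lemma splice_direction:
  obtains p :: "nat \<Rightarrow> complex \<Rightarrow> complex" and \<beta> :: "complex \<Rightarrow> complex" where
    "\<And>n. p n holomorphic_on UNIV" "\<beta> \<in> borel_measurable disc_measure" "\<And>z. norm (\<beta> z) \<le> 1"
    "\<And>z. Re z \<ge> 1/2 \<Longrightarrow> \<beta> z = 0"
    "\<And>n z. z \<in> disc \<Longrightarrow> Re z \<le> - 1/2 \<Longrightarrow> norm (p n z - 1) \<le> (1/2) ^ n"
    "(\<lambda>n. LINT z|disc_measure. norm (p n z) - Re (\<beta> z * p n z)) \<longlonglongrightarrow> 0"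
proof -
  interpret finite_measure disc_measure by (rule finite_measure_disc)
  obtain p :: "nat \<Rightarrow> complex \<Rightarrow> complex" and d :: "nat \<Rightarrow> real" where
    p: "\<And>n. p n holomorphic_on UNIV" and d: "\<And>n. d n > 0" "\<And>n. d (Suc n) \<le> d n"
    and gap: "\<And>n. (LINT z|disc_measure. norm (p n z) * indicator (gap (d (Suc n))) z) \<le> (1/2) ^ n"
    and pU: "\<And>n z. z \<in> disc \<Longrightarrow> Re z \<le> - 1/2 \<Longrightarrow> norm (p n z - 1) \<le> (1/2) ^ n"
    and pD: "\<And>n z. z \<in> disc \<Longrightarrow> Re z \<ge> 1/2 \<Longrightarrow> norm (p n z) \<le> (1/2) ^ n"
    and pK: "\<And>n z. z \<in> disc \<Longrightarrow> - 1/2 + d (Suc n) \<le> Re z \<Longrightarrow> Re z \<le> 1/2 - d (Suc n) \<Longrightarrow>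
       norm (p (Suc n) z - p n z) \<le> (1/2) ^ n"
    using splice_sequence by blast
  have cont: "continuous_on S (p n)" for n S
    using p[of n] by (meson continuous_on_subset holomorphic_on_imp_continuous_on subset_UNIV)
  have p_int: "integrable disc_measure (p n)" for n
    by (intro integrable_disc_continuous cont)
  then have [measurable]: "p n \<in> borel_measurable disc_measure" for n by auto
  define F where "F = (\<lambda>z. lim (\<lambda>n. p n z))"
  have [measurable]: "F \<in> borel_measurable disc_measure" unfolding F_def by measurable
  define \<beta> where "\<beta> = (\<lambda>z. if Re z \<ge> 1/2 then 0 else cnj (F z) / of_real (norm (F z)))"
  have Re_meas [measurable]: "Re \<in> borel_measurable disc_measure"
    by (intro borel_measurable_integrable integrable_disc_continuous continuous_intros)
  have "cnj \<in> borel_measurable borel"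
    by (intro borel_measurable_continuous_onI continuous_intros)
  then have cnj_meas: "(\<lambda>z. cnj (F z)) \<in> borel_measurable disc_measure"
    by (rule measurable_compose[rotated]) measurable
  have \<beta>_meas [measurable]: "\<beta> \<in> borel_measurable disc_measure"
    unfolding \<beta>_def using cnj_meas by measurable
  have \<beta>_le: "norm (\<beta> z) \<le> 1" for z by (simp add: \<beta>_def norm_divide)
  have pF: "norm (p n z - F z) \<le> 2 * (1/2) ^ n"
    if z: "z \<in> disc" "Re z < 1/2" "z \<notin> gap (d (Suc n))" for n z
  proof (cases "Re z \<le> - 1/2")
    case True
    have "(\<lambda>n. (1/2::real) ^ n) \<longlonglongrightarrow> 0" by (rule LIMSEQ_realpow_zero) auto
    then have "(\<lambda>n. p n z - 1) \<longlonglongrightarrow> 0"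
      by (rule Lim_null_comparison[rotated]) (use pU[OF z(1) True] in simp)
    then have "(\<lambda>n. p n z) \<longlonglongrightarrow> 1" by (rule LIM_zero_cancel)
    then have "F z = 1" by (simp add: F_def limI)
    then show ?thesis using order_trans[OF pU[OF z(1) True, of n], of "2 * (1/2) ^ n"] by simp
  next
    case False
    then have zn: "- 1/2 + d (Suc n) \<le> Re z" "Re z \<le> 1/2 - d (Suc n)"
      using z by (auto simp: gap_def)
    have "decseq d" using d(2) by (rule decseq_SucI)
    then have "d (Suc m) \<le> d (Suc n)" if "m \<ge> n" for m using that by (simp add: decseq_def)
    with zn have "- 1/2 + d (Suc m) \<le> Re z" "Re z \<le> 1/2 - d (Suc m)" if "m \<ge> n" for m
      using that by fastforce+
    then have "norm (p (Suc m) z - p m z) \<le> (1/2) ^ m" if "m \<ge> n" for m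
      using that z(1) by (intro pK) auto
    from geometric_increments_limit(2)[of n "\<lambda>n. p n z", OF this] show ?thesis
      by (simp add: F_def)
  qed
  \<comment> \<open>Pointwise bound of the defect: off the gap it is uniformly small, on the gap it is
    controlled by the mass of \<open>p n\<close>.\<close>
  have defect_le: "norm (p n z) - Re (\<beta> z * p n z) \<le>
      4 * (1/2) ^ n + 2 * (norm (p n z) * indicator (gap (d (Suc n))) z)" if z: "z \<in> disc" for n z
  proof -
    have "\<bar>Re (\<beta> z * p n z)\<bar> \<le> 1 * norm (p n z)"
      using abs_Re_le_cmod[of "\<beta> z * p n z"] mult_right_mono[OF \<beta>_le[of z], of "norm (p n z)"]
      by (simp add: norm_mult)
    then have le2: "norm (p n z) - Re (\<beta> z * p n z) \<le> 2 * norm (p n z)" by linarith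
    consider "Re z \<ge> 1/2" | "z \<in> gap (d (Suc n))" | "Re z < 1/2" "z \<notin> gap (d (Suc n))" by linarith
    then show ?thesis
    proof cases
      case 1
      then have "2 * norm (p n z) \<le> 4 * (1/2) ^ n"
        using pD[OF z 1, of n] by (simp add: order_trans[of _ "2 * (1/2) ^ n"])
      then show ?thesis using le2 by (simp add: add_increasing2)
    next
      case 2
      then show ?thesis using le2 by (simp add: add_increasing)
    next
      case 3
      then have "norm (p n z) - Re (\<beta> z * p n z) \<le> 2 * norm (p n z - F z)"
        using polar_defect_le[of "p n z" "F z"] by (simp add: \<beta>_def)
      also have "\<dots> \<le> 2 * (2 * (1/2) ^ n)" using pF[OF z 3] by simp
      finally show ?thesis using 3 by simp
    qed
  qed
  have defect_ge: "norm (p n z) - Re (\<beta> z * p n z) \<ge> 0" for n z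
  proof -
    have "Re (\<beta> z * p n z) \<le> norm (\<beta> z) * norm (p n z)"
      using complex_Re_le_cmod[of "\<beta> z * p n z"] by (simp add: norm_mult)
    also have "\<dots> \<le> 1 * norm (p n z)" using \<beta>_le by (intro mult_right_mono) auto
    finally show ?thesis by simp
  qed
  have \<beta>p_int: "integrable disc_measure (\<lambda>z. \<beta> z * p n z)" for n
    by (rule Bochner_Integration.integrable_bound[OF p_int[of n]])
       (auto simp: norm_mult intro!: mult_left_le_one_le \<beta>_le)
  have gap_meas [measurable]: "gap t \<in> sets disc_measure" for t by (rule gap_measurable)
  have gap_int: "integrable disc_measure (\<lambda>z. norm (p n z) * indicator (gap t) z)" for n t
    by (rule Bochner_Integration.integrable_bound[OF integrable_norm[OF p_int[of n]]])
       (auto simp: indicator_def)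
  have defect_int: "integrable disc_measure (\<lambda>z. norm (p n z) - Re (\<beta> z * p n z))" for n
    by (rule Bochner_Integration.integrable_diff[OF integrable_norm[OF p_int] integrable_Re[OF \<beta>p_int]])
  let ?m = "measure disc_measure (space disc_measure)"
  have int_le: "(LINT z|disc_measure. norm (p n z) - Re (\<beta> z * p n z)) \<le> (4 * ?m + 2) * (1/2) ^ n" for n
  proof -
    have "(LINT z|disc_measure. norm (p n z) - Re (\<beta> z * p n z)) \<le>
        (LINT z|disc_measure. 4 * (1/2) ^ n + 2 * (norm (p n z) * indicator (gap (d (Suc n))) z))"
    proof (rule integral_mono[OF defect_int])
      show "integrable disc_measure
          (\<lambda>z. 4 * (1/2) ^ n + 2 * (norm (p n z) * indicator (gap (d (Suc n))) z))"
        using gap_int by auto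
    qed (use defect_le in \<open>simp add: space_restrict_space\<close>)
    also have "\<dots> = ?m * (4 * (1/2) ^ n) + 2 * (LINT z|disc_measure. norm (p n z) * indicator (gap (d (Suc n))) z)"
      using gap_int by simp
    also have "\<dots> \<le> ?m * (4 * (1/2) ^ n) + 2 * (1/2) ^ n" using gap[of n] by simp
    finally show ?thesis by (simp add: algebra_simps)
  qed
  have "(\<lambda>n. (4 * ?m + 2) * (1/2) ^ n) \<longlonglongrightarrow> (4 * ?m + 2) * 0"
    by (intro tendsto_intros LIMSEQ_realpow_zero) auto
  then have bound0: "(\<lambda>n. (4 * ?m + 2) * (1/2) ^ n) \<longlonglongrightarrow> 0" by simp
  have lim0: "(\<lambda>n. LINT z|disc_measure. norm (p n z) - Re (\<beta> z * p n z)) \<longlonglongrightarrow> 0"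
  proof (rule tendsto_sandwich[OF always_eventually always_eventually tendsto_const bound0])
    show "\<forall>n. 0 \<le> (LINT z|disc_measure. norm (p n z) - Re (\<beta> z * p n z))"
      using defect_ge by (intro allI Bochner_Integration.integral_nonneg)
    show "\<forall>n. (LINT z|disc_measure. norm (p n z) - Re (\<beta> z * p n z)) \<le> (4 * ?m + 2) * (1/2) ^ n"
      using int_le by blast
  qed
  show thesis
    by (rule that[OF p \<beta>_meas \<beta>_le _ pU lim0]) (simp add: \<beta>_def)
qed

section \<open>A function annihilating all holomorphic functions\<close>

lemma mean_value_circle:
  fixes f :: "complex \<Rightarrow> complex"
  assumes "f holomorphic_on cball z r" "r > 0"
  shows "(LINT t|lborel. indicator {0..1} t *\<^sub>R f (z + of_real r * cis (2 * pi * t))) = f z"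
proof -
  have cont: "continuous_on (cball z r) f"
    using assms(1) by (rule holomorphic_on_imp_continuous_on)
  have in_cball: "z + of_real r * cis (2 * pi * t) \<in> cball z r" for t
    using assms(2) by (simp add: dist_norm norm_mult)
  have "((\<lambda>u. f u / (u - z)) has_contour_integral (2 * of_real pi * \<i> * f z)) (circlepath z r)"
    using assms cont by (intro Cauchy_integral_circlepath) (auto intro: holomorphic_on_subset)
  then have "((\<lambda>t. f (circlepath z r t) / (circlepath z r t - z) *
      vector_derivative (circlepath z r) (at t within {0..1})) has_integral 2 * of_real pi * \<i> * f z) {0..1}"
    by (simp add: has_contour_integral_def)
  then have "((\<lambda>t. 2 * of_real pi * \<i> * f (z + of_real r * cis (2 * pi * t))) has_integral
      2 * of_real pi * \<i> * f z) {0..1}"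
  proof (rule has_integral_eq[rotated])
    fix t :: real assume t: "t \<in> {0..1}"
    show "f (circlepath z r t) / (circlepath z r t - z) *
      vector_derivative (circlepath z r) (at t within {0..1}) =
      2 * of_real pi * \<i> * f (z + of_real r * cis (2 * pi * t))"
      using assms(2) t
      by (subst vector_derivative_circlepath01) (auto simp: circlepath cis_conv_exp mult_ac)
  qed
  then have "((\<lambda>t. 1 / (2 * of_real pi * \<i>) * (2 * of_real pi * \<i> * f (z + of_real r * cis (2 * pi * t))))
      has_integral 1 / (2 * of_real pi * \<i>) * (2 * of_real pi * \<i> * f z)) {0..1}"
    by (rule has_integral_mult_right)
  then have hi: "((\<lambda>t. f (z + of_real r * cis (2 * pi * t))) has_integral f z) {0..1}"
    by simp
  have "continuous_on {0..1} (\<lambda>t. f (z + of_real r * cis (2 * pi * t)))"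
    using in_cball by (intro continuous_on_compose2[OF cont] continuous_intros) auto
  then have "set_integrable lborel {0..1} (\<lambda>t. f (z + of_real r * cis (2 * pi * t)))"
    by (rule borel_integrable_atLeastAtMost')
  from set_borel_integral_eq_integral(2)[OF this] hi show ?thesis
    by (simp add: set_lebesgue_integral_def integral_unique)
qed

lemma integrable_lborel_bounded_support:
  fixes F :: "'a::euclidean_space \<Rightarrow> 'b::{banach, second_countable_topology}"
  assumes "F \<in> borel_measurable borel" "\<And>x. norm (F x) \<le> M" "bounded C" "C \<in> sets borel"
    "\<And>x. x \<notin> C \<Longrightarrow> F x = 0"
  shows "integrable lborel F"
proof (rule Bochner_Integration.integrable_bound)
  show "integrable lborel (\<lambda>x. M * indicator C x)"
    using emeasure_bounded_finite[OF assms(3)] assms(4)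
    by (intro integrable_mult_right integrable_real_indicator) auto
  show "AE x in lborel. norm (F x) \<le> norm (M * indicator C x)"
  proof (rule AE_I2)
    fix x
    show "norm (F x) \<le> norm (M * indicator C x)"
      using assms(2)[of x] assms(5)[of x] by (auto simp: indicator_def)
  qed
qed (use assms in auto)

text \<open>
  The circle of radius 1/8 keeps every translate of the ball \<open>B\<close> of radius 1/20 disjoint
  from \<open>B\<close>, whence \<open>\<eta> = 1\<close> on \<open>B\<close>, and inside \<open>ball (3/4) (1/5)\<close>. That \<open>\<eta>\<close> annihilates
  \<open>\<psi>\<close> is the mean value property integrated over \<open>B\<close>, with the two integrals exchanged
  and the translation moved from \<open>\<psi>\<close> to \<open>B\<close>.
\<close>

lemma annihilator_exists:
  obtains \<eta> :: "complex \<Rightarrow> complex" and B where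
    "\<eta> \<in> borel_measurable borel" "\<And>z. norm (\<eta> z) \<le> 1"
    "\<And>z. z \<notin> ball (3/4) (1/5) \<Longrightarrow> \<eta> z = 0"
    "open B" "B \<noteq> {}" "B \<subseteq> ball (3/4) (1/5)" "\<And>z. z \<in> B \<Longrightarrow> \<eta> z = 1"
    "\<And>\<psi>. \<psi> holomorphic_on disc \<Longrightarrow> (LINT z|disc_measure. \<eta> z * \<psi> z) = 0"
proof -
  define B :: "complex set" where "B = ball (3/4) (1/20)"
  define e where "e = (\<lambda>t. of_real (1/8) * cis (2 * pi * t))"
  have norm_e: "norm (e t) = 1/8" for t by (simp add: e_def norm_mult)
  have [measurable]: "B \<in> sets borel" by (simp add: B_def)
  have [measurable]: "e \<in> borel_measurable borel"
    unfolding e_def by (intro borel_measurable_continuous_onI continuous_intros)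
  \<comment> \<open>The average over the circle of the indicator functions of the translates of \<open>B\<close>.\<close>
  define a :: "complex \<Rightarrow> real" where
    "a = (\<lambda>z. LINT t|lborel. indicator {0..1} t * indicator B (z - e t))"
  have a_meas [measurable]: "a \<in> borel_measurable borel"
    unfolding a_def by measurable
  have a_int: "integrable lborel (\<lambda>t. indicator {0..1} t * indicator B (z - e t) :: real)" for z
    by (rule integrable_lborel_bounded_support[where C = "{0..1}" and M = 1])
       (auto simp: indicator_def)
  have a_le: "0 \<le> a z" "a z \<le> 1" for z
  proof -
    show "0 \<le> a z" unfolding a_def by (intro integral_nonneg_AE) auto
    have "a z \<le> (LINT t|lborel. indicator {0..1::real} t)"
      unfolding a_def
    proof (rule integral_mono)
      show "integrable lborel (\<lambda>t. indicator {0..1} t * indicator B (z - e t) :: real)"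
        by (rule a_int)
      show "integrable lborel (indicator {0..1::real} :: real \<Rightarrow> real)"
        by (rule integrable_real_indicator) auto
    qed (auto simp: indicator_def)
    then show "a z \<le> 1" by simp
  qed
  have a_far: "a z = 0" if "z \<notin> ball (3/4) (1/5)" for z
  proof -
    have "z - e t \<notin> B" for t
    proof
      assume "z - e t \<in> B"
      then have "norm (3/4 - (z - e t)) < 1/20" by (simp add: B_def dist_norm)
      moreover have "3/4 - z = (3/4 - (z - e t)) - e t" by simp
      ultimately have "norm (3/4 - z) < 1/20 + 1/8"
        using norm_triangle_ineq4[of "3/4 - (z - e t)" "e t"] norm_e[of t] by simp
      with that show False by (simp add: dist_norm)
    qed
    then show ?thesis by (simp add: a_def)
  qed
  have a_B: "a z = 0" if "z \<in> B" for z
  proof -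
    have "z - e t \<notin> B" for t
    proof
      assume "z - e t \<in> B"
      then have "norm (3/4 - (z - e t)) < 1/20" by (simp add: B_def dist_norm)
      moreover have "norm (3/4 - z) < 1/20" using that by (simp add: B_def dist_norm)
      moreover have "e t = (3/4 - (z - e t)) - (3/4 - z)" by simp
      ultimately show False
        using norm_triangle_ineq4[of "3/4 - (z - e t)" "3/4 - z"] norm_e[of t] by simp
    qed
    then show ?thesis by (simp add: a_def)
  qed
  define \<eta> :: "complex \<Rightarrow> complex" where "\<eta> = (\<lambda>z. of_real (indicator B z - a z))"
  have \<eta>_meas [measurable]: "\<eta> \<in> borel_measurable borel"
    unfolding \<eta>_def by measurable
  have B_sub: "B \<subseteq> ball (3/4) (1/5)" by (auto simp: B_def)
  have \<eta>_far: "\<eta> z = 0" if "z \<notin> ball (3/4) (1/5)" for z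
  proof -
    have "z \<notin> B" using B_sub that by blast
    then show ?thesis using a_far[OF that] by (simp add: \<eta>_def)
  qed
  have ball_disc: "cball (3/4) (1/5) \<subseteq> disc"
  proof
    fix z :: complex assume "z \<in> cball (3/4) (1/5)"
    then have "norm (3/4 - z) \<le> 1/5" by (simp add: dist_norm)
    moreover have "norm (3/4 :: complex) = 3/4" by simp
    ultimately have "norm z \<le> 3/4 + 1/5" using norm_triangle_ineq4[of "3/4" "3/4 - z"] by simp
    then show "z \<in> disc" by simp
  qed
  have annih: "(LINT z|disc_measure. \<eta> z * \<psi> z) = 0" if \<psi>: "\<psi> holomorphic_on disc" for \<psi>
  proof -
    let ?C = "cball (3/4 :: complex) (1/5)"
    \<comment> \<open>Truncating \<open>\<psi>\<close> makes it a bounded Borel function on the whole plane, so that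
      translations and Fubini can be used with respect to Lebesgue measure.\<close>
    define f where "f = (\<lambda>z. indicator ?C z *\<^sub>R \<psi> z)"
    have hol: "\<psi> holomorphic_on ?C" using \<psi> ball_disc by (rule holomorphic_on_subset)
    have cont: "continuous_on ?C \<psi>" using hol by (rule holomorphic_on_imp_continuous_on)
    have f_meas [measurable]: "f \<in> borel_measurable borel"
      unfolding f_def using cont by (intro borel_measurable_continuous_on_indicator) auto
    have "bounded (\<psi> ` ?C)" using cont by (intro compact_imp_bounded compact_continuous_image) auto
    then obtain M where M: "M > 0" "\<And>z. z \<in> ?C \<Longrightarrow> norm (\<psi> z) \<le> M"
      unfolding bounded_pos by blast
    then have f_le: "norm (f z) \<le> M" for z by (auto simp: f_def indicator_def)
    have f_far: "f z = 0" if "z \<notin> ?C" for z using that by (simp add: f_def)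
    have f_eq: "f z = \<psi> z" if "z \<in> ?C" for z using that by (simp add: f_def)
    have circ: "cball z (1/8) \<subseteq> ?C" if "z \<in> B" for z
    proof
      fix w assume "w \<in> cball z (1/8)"
      then have "dist z w \<le> 1/8" by simp
      moreover have "dist (3/4) z < 1/20" using that by (simp add: B_def)
      ultimately show "w \<in> ?C" using dist_triangle[of "3/4" w z] by simp
    qed
    have mv: "(LINT t|lborel. indicator {0..1} t *\<^sub>R f (z + e t)) = f z" if "z \<in> B" for z
    proof -
      have "z + e t \<in> cball z (1/8)" for t
        using norm_e[of t] by (simp add: dist_norm)
      then have "f (z + e t) = \<psi> (z + e t)" for t
        using circ[OF that] by (intro f_eq) blast
      moreover have "z \<in> cball z (1/8)" by simp
      then have "f z = \<psi> z" using circ[OF that] by (intro f_eq) blast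
      ultimately show ?thesis
        using mean_value_circle[OF holomorphic_on_subset[OF hol circ[OF that]]] by (simp add: e_def)
    qed
    have "(LINT z|lborel. indicator B z *\<^sub>R f z) =
        (LINT z|lborel. LINT t|lborel. indicator B z *\<^sub>R indicator {0..1} t *\<^sub>R f (z + e t))"
    proof (rule Bochner_Integration.integral_cong[OF refl])
      fix z
      show "indicator B z *\<^sub>R f z = (LINT t|lborel. indicator B z *\<^sub>R indicator {0..1} t *\<^sub>R f (z + e t))"
        using mv[of z] by (cases "z \<in> B") auto
    qed
    also have "\<dots> = (LINT t|lborel. LINT z|lborel. indicator B z *\<^sub>R indicator {0..1} t *\<^sub>R f (z + e t))"
    proof (rule lborel_pair.Fubini_integral[symmetric], unfold lborel_prod)
      show "integrable lborel (\<lambda>(z, t). indicator B z *\<^sub>R indicator {0..1} t *\<^sub>R f (z + e t))"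
      proof (rule integrable_lborel_bounded_support[where C = "cball (3/4) 1 \<times> {0..1}" and M = M])
        show "(\<lambda>(z, t). indicator B z *\<^sub>R indicator {0..1} t *\<^sub>R f (z + e t)) \<in> borel_measurable borel"
          unfolding borel_prod[symmetric] by measurable
      qed (use f_le M(1) in \<open>auto simp: indicator_def B_def intro!: bounded_Times borel_closed closed_Times\<close>)
    qed
    also have "\<dots> = (LINT t|lborel. LINT z|lborel. indicator B (z - e t) *\<^sub>R indicator {0..1} t *\<^sub>R f z)"
    proof (rule Bochner_Integration.integral_cong[OF refl])
      fix t :: real
      let ?h = "\<lambda>z. indicator B (z - e t) *\<^sub>R indicator {0..1} t *\<^sub>R f z"
      have "(LINT z|lborel. ?h z) = (LINT z|distr lborel borel ((+) (e t)). ?h z)"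
        by (simp add: lborel_distr_plus)
      also have "\<dots> = (LINT z|lborel. ?h (e t + z))"
        by (rule integral_distr) measurable
      finally show "(LINT z|lborel. indicator B z *\<^sub>R indicator {0..1} t *\<^sub>R f (z + e t)) =
          (LINT z|lborel. ?h z)"
        by (simp add: add.commute)
    qed
    also have "\<dots> = (LINT z|lborel. LINT t|lborel. indicator B (z - e t) *\<^sub>R indicator {0..1} t *\<^sub>R f z)"
    proof (rule lborel_pair.Fubini_integral, unfold lborel_prod)
      show "integrable lborel (\<lambda>(z, t). indicator B (z - e t) *\<^sub>R indicator {0..1} t *\<^sub>R f z)"
      proof (rule integrable_lborel_bounded_support[where C = "?C \<times> {0..1}" and M = M])
        show "(\<lambda>(z, t). indicator B (z - e t) *\<^sub>R indicator {0..1} t *\<^sub>R f z) \<in> borel_measurable borel"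
          unfolding borel_prod[symmetric] by measurable
        show "(case x of (z, t) \<Rightarrow> indicator B (z - e t) *\<^sub>R indicator {0..1} t *\<^sub>R f z) = 0"
          if "x \<notin> ?C \<times> {0..1}" for x
          using that f_far[of "fst x"] by (cases x) (auto simp: indicator_def simp del: mem_cball)
      qed (use f_le M(1) in \<open>auto simp: indicator_def intro!: bounded_Times borel_closed closed_Times\<close>)
    qed
    also have "\<dots> = (LINT z|lborel. a z *\<^sub>R f z)"
      unfolding a_def
      by (subst integral_scaleR_left[symmetric, OF a_int]) (simp add: mult.commute)
    finally have eq: "(LINT z|lborel. indicator B z *\<^sub>R f z) = (LINT z|lborel. a z *\<^sub>R f z)" .
    have "(LINT z|disc_measure. \<eta> z * \<psi> z) = (LINT z|lebesgue. indicator disc z *\<^sub>R (\<eta> z * \<psi> z))"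
      by (rule integral_restrict_space) auto
    also have "\<dots> = (LINT z|lebesgue. indicator B z *\<^sub>R f z - a z *\<^sub>R f z)"
    proof (rule Bochner_Integration.integral_cong[OF refl])
      fix z
      show "indicator disc z *\<^sub>R (\<eta> z * \<psi> z) = indicator B z *\<^sub>R f z - a z *\<^sub>R f z"
      proof (cases "z \<in> ball (3/4) (1/5)")
        case True
        then have "z \<in> ?C" by auto
        moreover from this have "z \<in> disc" using ball_disc by blast
        ultimately show ?thesis using f_eq[of z]
          by (simp add: \<eta>_def scaleR_conv_of_real left_diff_distrib)
      next
        case False
        moreover from this have "z \<notin> B" using B_sub by blast
        ultimately show ?thesis using a_far \<eta>_far by simp
      qed
    qed
    also have "\<dots> = (LINT z|lborel. indicator B z *\<^sub>R f z - a z *\<^sub>R f z)"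
      by (rule integral_completion) measurable
    also have "\<dots> = (LINT z|lborel. indicator B z *\<^sub>R f z) - (LINT z|lborel. a z *\<^sub>R f z)"
    proof (rule Bochner_Integration.integral_diff)
      have le: "norm (x *\<^sub>R f z) \<le> M" if "0 \<le> x" "x \<le> 1" for x z
        using mult_mono[of x 1 "norm (f z)" M] that f_le by simp
      show "integrable lborel (\<lambda>z. indicator B z *\<^sub>R f z)"
      proof (rule integrable_lborel_bounded_support[where C = ?C and M = M])
        show "norm (indicator B z *\<^sub>R f z) \<le> M" for z by (rule le) auto
      qed (auto simp: f_far simp del: mem_cball)
      show "integrable lborel (\<lambda>z. a z *\<^sub>R f z)"
      proof (rule integrable_lborel_bounded_support[where C = ?C and M = M])
        show "norm (a z *\<^sub>R f z) \<le> M" for z by (rule le) (use a_le in auto)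
      qed (auto simp: f_far simp del: mem_cball)
    qed
    also have "\<dots> = 0" using eq by simp
    finally show ?thesis .
  qed
  have \<eta>_le: "norm (\<eta> z) \<le> 1" for z
    using a_le[of z] unfolding \<eta>_def norm_of_real by (auto simp: indicator_def)
  have B_ne: "open B" "B \<noteq> {}" by (auto simp: B_def)
  have \<eta>_B: "\<eta> z = 1" if "z \<in> B" for z using a_B[OF that] that by (simp add: \<eta>_def)
  show thesis
    by (rule that[OF \<eta>_meas \<eta>_le \<eta>_far B_ne B_sub \<eta>_B annih])
qed

section \<open>Functions of Teichmueller form that are constant on an open set\<close>

text \<open>
  The imaginary part is assumed to vanish only almost everywhere; by continuity it then
  vanishes everywhere on \<open>V\<close>, and the open mapping theorem gives the conclusion.
\<close>

lemma holomorphic_AE_real_constant: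
  assumes hol: "f holomorphic_on V" and V: "open V" "connected V" "V \<subseteq> disc" 
    and re: "AE z in disc_measure. z \<in> V \<longrightarrow> Im (f z) = 0"
  shows "f constant_on V"
proof (rule ccontr)
  assume nc: "\<not> f constant_on V"
  then have "open (f ` V)" and "V \<noteq> {}"
    using open_mapping_thm[OF hol V(1,2) V(1)] by (auto simp: constant_on_def)
  have cont: "continuous_on V f" using hol by (rule holomorphic_on_imp_continuous_on)
  define W where "W = V \<inter> f -` {w. Im w \<noteq> 0}"
  have "open W" unfolding W_def
    by (intro continuous_open_preimage cont V open_Collect_neq continuous_intros)
  moreover have "W \<noteq> {}"
  proof
    assume "W = {}"
    then have "f ` V \<subseteq> {w. Im w = 0}" by (auto simp: W_def)
    moreover obtain v where "v \<in> f ` V" using \<open>V \<noteq> {}\<close> by blast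
    moreover obtain e where "e > 0" "ball v e \<subseteq> f ` V"
      using \<open>open (f ` V)\<close> \<open>v \<in> f ` V\<close> by (meson open_contains_ball)
    moreover have "v + of_real (e/2) * \<i> \<in> ball v e"
      using \<open>e > 0\<close> by (simp add: dist_norm norm_mult)
    ultimately have "Im (v + of_real (e/2) * \<i>) = 0" "Im v = 0" by blast+
    with \<open>e > 0\<close> show False by simp
  qed
  ultimately obtain z where "z \<in> W" "z \<in> V \<longrightarrow> Im (f z) = 0"
    using AE_disc_open_witness[OF re, of W] V(3) by (auto simp: W_def)
  then show False by (auto simp: W_def)
qed

text \<open>
  If \<open>k * cnj \<phi> / norm \<phi>\<close> is a positive constant on an open set, then \<open>\<phi>\<close> is real there,
  hence constant there, and hence constant on the disc off a sparse set by the identity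
  theorem for meromorphic functions.
\<close>

lemma teichmueller_constant_on_open_set:
  assumes mero: "\<phi> meromorphic_on disc" and nz: "\<not> (\<forall>\<^sub>\<approx>z\<in>disc. \<phi> z = 0)"
    and \<nu>: "AE z in disc_measure. \<nu> z = of_real k * cnj (\<phi> z) / of_real (norm (\<phi> z))"
    and U: "open U" "U \<subseteq> disc" "U \<noteq> {}" 
    and m: "m > 0" "AE z in disc_measure. z \<in> U \<longrightarrow> \<nu> z = of_real (m::real)"
  shows "AE z in disc_measure. \<nu> z = of_real m"
proof -
  have ana: "AE z in disc_measure. \<phi> analytic_on {z}"
    using mero by (intro AE_disc_cosparse meromorphic_on_imp_analytic_cosparse)
  obtain z0 where z0: "z0 \<in> U" "\<phi> analytic_on {z0}"
    using AE_disc_open_witness[OF ana U(1,2,3)] .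
  then obtain r where r: "r > 0" "\<phi> holomorphic_on ball z0 r"
    by (auto simp: analytic_on_def)
  obtain s where s: "s > 0" "ball z0 s \<subseteq> U" using z0(1) U(1) by (meson open_contains_ball)
  define V where "V = ball z0 (min r s)"
  have V: "open V" "connected V" "V \<subseteq> U" "z0 \<in> V" using r s by (auto simp: V_def)
  have hol: "\<phi> holomorphic_on V" using r(2) by (rule holomorphic_on_subset) (auto simp: V_def)
  have "AE z in disc_measure. z \<in> V \<longrightarrow> Im (\<phi> z) = 0"
    using \<nu> m(2)
  proof eventually_elim
    case (elim z)
    show ?case
    proof
      assume "z \<in> V"
      then have eq: "of_real k * cnj (\<phi> z) / of_real (norm (\<phi> z)) = of_real m"
        using elim V(3) by auto
      then have "\<phi> z \<noteq> 0" "k \<noteq> 0" using m(1) by auto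
      then have "cnj (\<phi> z) = of_real (m * norm (\<phi> z) / k)"
        using eq by (simp add: field_simps)
      then have "Im (cnj (\<phi> z)) = 0" by (metis Im_complex_of_real)
      then show "Im (\<phi> z) = 0" by simp
    qed
  qed
  then have "\<phi> constant_on V"
    using hol V U(2) by (intro holomorphic_AE_real_constant) auto
  then obtain c where c: "\<And>z. z \<in> V \<Longrightarrow> \<phi> z = c" by (auto simp: constant_on_def)
  have "\<not> (\<forall>\<^sub>\<approx>z\<in>disc. \<phi> z \<noteq> c)"
  proof
    assume "\<forall>\<^sub>\<approx>z\<in>disc. \<phi> z \<noteq> c"
    from AE_disc_open_witness[OF AE_disc_cosparse[OF this] V(1)] V U(2) c show False by blast
  qed
  then have "\<forall>\<^sub>\<approx>z\<in>disc. \<phi> z = c"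
    using meromorphic_imp_constant_or_avoid[OF mero, of c] by auto
  then have "AE z in disc_measure. \<phi> z = c" by (rule AE_disc_cosparse)
  with \<nu> have const: "AE z in disc_measure. \<nu> z = of_real k * cnj c / of_real (norm c)"
    by eventually_elim simp
  with m(2) have "AE z in disc_measure. z \<in> U \<longrightarrow> of_real k * cnj c / of_real (norm c) = (of_real m :: complex)"
    by eventually_elim simp
  from AE_disc_open_witness[OF this U] have "of_real k * cnj c / of_real (norm c) = (of_real m :: complex)"
    by blast
  with const show ?thesis by simp
qed

section \<open>Extremality and forced values\<close>

text \<open>
  The \<open>p n\<close> play the role of a Hamilton sequence for \<open>\<mu>\<close>, but without normalisation. They
  see only the class of \<open>\<mu>\<close>, so the integrals of the defects of \<open>\<nu>\<close>
  agree with those of \<open>\<mu>\<close> and tend to 0. The defect of \<open>\<nu>\<close> is nonnegative and, on the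
  left part, uniformly close to \<open>k - Re \<nu>\<close>. No bound on the norms of the \<open>p n\<close> is
  needed.
\<close>

lemma hamilton_forces_direction:
  fixes p :: "nat \<Rightarrow> complex \<Rightarrow> complex"
  assumes p: "\<And>n. p n holomorphic_on UNIV"
    and pU: "\<And>n z. z \<in> disc \<Longrightarrow> Re z \<le> - 1/2 \<Longrightarrow> norm (p n z - 1) \<le> (1/2) ^ n"
    and def0: "(\<lambda>n. LINT z|disc_measure. k * norm (p n z) - Re (\<mu> z * p n z)) \<longlonglongrightarrow> 0"
    and \<nu>: "(\<mu>, \<nu>) \<in> inf_equiv" and \<nu>_le: "AE z in disc_measure. norm (\<nu> z) \<le> k"
  shows "AE z in disc_measure. Re z \<le> - 1/2 \<longrightarrow> \<nu> z = of_real k"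
proof -
  interpret finite_measure disc_measure by (rule finite_measure_disc)
  have \<mu>L: "\<mu> \<in> Linf" and \<nu>L: "\<nu> \<in> Linf" using \<nu> by (auto simp: inf_equiv_def)
  have pA: "p n \<in> A_disc" for n using p by (rule A_disc_entire)
  have p_int: "integrable disc_measure (p n)" for n using pA by (simp add: A_disc_def)
  have \<mu>p: "integrable disc_measure (\<lambda>z. \<mu> z * p n z)" 
    and \<nu>p: "integrable disc_measure (\<lambda>z. \<nu> z * p n z)" for n
    using integrable_Linf_mult[OF \<mu>L pA] integrable_Linf_mult[OF \<nu>L pA] by auto
  have \<nu>_meas [measurable]: "\<nu> \<in> borel_measurable disc_measure" using \<nu>L by (simp add: Linf_iff_bounded)
  have \<nu>_int: "integrable disc_measure \<nu>"
    by (rule integrable_const_bound[OF \<nu>_le \<nu>_meas])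
  have Re_meas [measurable]: "Re \<in> borel_measurable disc_measure"
    by (intro borel_measurable_integrable integrable_disc_continuous continuous_intros)
  define U where "U = {z\<in>disc. Re z \<le> - 1/2}"
  have [measurable]: "U \<in> sets disc_measure"
  proof -
    have "{z \<in> space disc_measure. Re z \<le> - 1/2} \<in> sets disc_measure" by measurable
    then show ?thesis by (simp add: U_def space_restrict_space)
  qed
  \<comment> \<open>The limit of the defects of \<open>\<nu>\<close> on the left part; its integral turns out to be 0.\<close>
  define g where "g = (\<lambda>z. indicator U z * (k - Re (\<nu> z)))"
  have k0: "k \<ge> 0"
  proof -
    obtain z where "norm (\<nu> z) \<le> k" using AE_disc_open_witness[OF \<nu>_le, of disc] by auto
    then show ?thesis using norm_ge_zero order_trans by blast
  qed
  have g_int: "integrable disc_measure g"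
    unfolding g_def
    by (rule Bochner_Integration.integrable_bound[of _ "\<lambda>z. k - Re (\<nu> z)"])
       (use \<nu>_int in \<open>auto simp: indicator_def\<close>)
  have g_nonneg: "AE z in disc_measure. 0 \<le> g z"
    using \<nu>_le
  proof eventually_elim
    case (elim z)
    then show ?case using complex_Re_le_cmod[of "\<nu> z"] by (simp add: g_def indicator_def)
  qed
  have defect_int: "integrable disc_measure (\<lambda>z. k * norm (p n z) - Re (\<nu> z * p n z))" for n
    by (rule Bochner_Integration.integrable_diff[OF integrable_mult_right[OF integrable_norm[OF p_int]] integrable_Re[OF \<nu>p]])
  have defect_eq: "(LINT z|disc_measure. k * norm (p n z) - Re (\<nu> z * p n z)) =
      (LINT z|disc_measure. k * norm (p n z) - Re (\<mu> z * p n z))" for n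
  proof -
    have "(LINT z|disc_measure. \<mu> z * p n z) = (LINT z|disc_measure. \<nu> z * p n z)"
      using \<nu> pA by (auto simp: inf_equiv_def)
    then have "(LINT z|disc_measure. Re (\<mu> z * p n z)) = (LINT z|disc_measure. Re (\<nu> z * p n z))"
      using integral_Re[OF \<mu>p] integral_Re[OF \<nu>p] by metis
    moreover have "(LINT z|disc_measure. k * norm (p n z) - Re (w z * p n z)) =
        (LINT z|disc_measure. k * norm (p n z)) - (LINT z|disc_measure. Re (w z * p n z))"
      if "integrable disc_measure (\<lambda>z. w z * p n z)" for w
      by (rule Bochner_Integration.integral_diff[OF integrable_mult_right[OF integrable_norm[OF p_int]]
            integrable_Re[OF that]])
    ultimately show ?thesis using \<mu>p \<nu>p by presburger
  qed
  let ?m = "measure disc_measure (space disc_measure)"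
  have le: "integral\<^sup>L disc_measure g \<le>
      (LINT z|disc_measure. k * norm (p n z) - Re (\<mu> z * p n z)) + 2 * k * (1/2) ^ n * ?m" for n
  proof -
    have "integral\<^sup>L disc_measure g \<le>
        (LINT z|disc_measure. (k * norm (p n z) - Re (\<nu> z * p n z)) + 2 * k * (1/2) ^ n)"
    proof (rule integral_mono_AE[OF g_int])
      show "integrable disc_measure (\<lambda>z. (k * norm (p n z) - Re (\<nu> z * p n z)) + 2 * k * (1/2) ^ n)"
        using defect_int by (rule Bochner_Integration.integrable_add) auto
      have "AE z in disc_measure. z \<in> disc" by (rule AE_I2) (simp add: space_restrict_space)
      then show "AE z in disc_measure. g z \<le> (k * norm (p n z) - Re (\<nu> z * p n z)) + 2 * k * (1/2) ^ n"
        using \<nu>_le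
      proof eventually_elim
        case (elim z)
        have mul: "norm (\<nu> z * w) \<le> k * norm w" for w
          using elim by (simp add: norm_mult mult_right_mono)
        show ?case
        proof (cases "z \<in> U")
          case True
          then have 1: "norm (p n z - 1) \<le> (1/2) ^ n" using pU by (auto simp: U_def)
          then have kle: "k * norm (p n z - 1) \<le> k * (1/2) ^ n" using k0 by (rule mult_left_mono)
          have "norm (1::complex) \<le> norm (p n z) + norm (p n z - 1)"
            by (metis norm_minus_commute norm_triangle_sub)
          then have "k * 1 \<le> k * (norm (p n z) + norm (p n z - 1))"
            using k0 by (intro mult_left_mono) auto
          moreover have "Re (\<nu> z * p n z) = Re (\<nu> z) + Re (\<nu> z * (p n z - 1))"
            by (simp add: algebra_simps)
          moreover have "\<bar>Re (\<nu> z * (p n z - 1))\<bar> \<le> k * norm (p n z - 1)"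
            by (rule order_trans[OF abs_Re_le_cmod mul])
          ultimately show ?thesis using True kle by (simp add: g_def distrib_left del: times_complex.sel)
        next
          case False
          have "Re (\<nu> z * p n z) \<le> k * norm (p n z)"
            by (rule order_trans[OF complex_Re_le_cmod mul])
          moreover have "2 * k * (1/2) ^ n \<ge> 0" using k0 by simp
          ultimately show ?thesis using False by (simp add: g_def del: times_complex.sel)
        qed
      qed
    qed
    also have "\<dots> = (LINT z|disc_measure. k * norm (p n z) - Re (\<nu> z * p n z)) + 2 * k * (1/2) ^ n * ?m"
      by (subst Bochner_Integration.integral_add[OF defect_int]) auto
    finally show ?thesis unfolding defect_eq .
  qed
  have "(\<lambda>n. (LINT z|disc_measure. k * norm (p n z) - Re (\<mu> z * p n z)) + 2 * k * (1/2) ^ n * ?m) \<longlonglongrightarrow>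
      0 + 2 * k * 0 * ?m"
    by (intro tendsto_intros def0 LIMSEQ_realpow_zero) auto
  then have "integral\<^sup>L disc_measure g \<le> 0 + 2 * k * 0 * ?m"
    by (rule LIMSEQ_le_const) (use le in blast)
  moreover have "integral\<^sup>L disc_measure g \<ge> 0" using g_nonneg by (rule integral_nonneg_AE)
  ultimately have "integral\<^sup>L disc_measure g = 0" by simp
  then have "AE z in disc_measure. g z = 0"
    using integral_nonneg_eq_0_iff_AE[OF g_int g_nonneg] by blast
  moreover have "AE z in disc_measure. z \<in> disc" by (rule AE_I2) (simp add: space_restrict_space)
  ultimately show ?thesis
    using \<nu>_le
  proof eventually_elim
    case (elim z)
    show ?case
    proof
      assume "Re z \<le> - 1/2"
      with elim have Rez: "Re (\<nu> z) = k" by (auto simp: g_def U_def)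
      have "(norm (\<nu> z))\<^sup>2 \<le> k\<^sup>2" using elim by (intro power_mono) auto
      then have "Im (\<nu> z) = 0" using Rez by (simp add: cmod_power2)
      with Rez show "\<nu> z = of_real k" by (simp add: complex_eq_iff)
    qed
  qed
qed

lemma left_open:
  "open (disc \<inter> {z. Re z < - 1/2})" "disc \<inter> {z. Re z < - 1/2} \<noteq> {}"
proof -
  show "open (disc \<inter> {z. Re z < - 1/2})" by (intro open_Int open_ball open_halfspace_Re_lt)
  have "(- 3/4 :: complex) \<in> disc \<inter> {z. Re z < - 1/2}" by simp
  then show "disc \<inter> {z. Re z < - 1/2} \<noteq> {}" by blast
qed

text \<open>
  An equivalent element of norm less than \<open>k\<close> would have to equal \<open>k\<close> on the left part
  by the preceding forcing result.
\<close>

lemma hamilton_extremal: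
  fixes p :: "nat \<Rightarrow> complex \<Rightarrow> complex"
  assumes p: "\<And>n. p n holomorphic_on UNIV"
    and pU: "\<And>n z. z \<in> disc \<Longrightarrow> Re z \<le> - 1/2 \<Longrightarrow> norm (p n z - 1) \<le> (1/2) ^ n"
    and def0: "(\<lambda>n. LINT z|disc_measure. k * norm (p n z) - Re (\<mu> z * p n z)) \<longlonglongrightarrow> 0"
    and \<mu>: "\<mu> \<in> borel_measurable disc_measure" "AE z in disc_measure. norm (\<mu> z) \<le> k"
  shows "extremal \<mu>" "Linf_norm \<mu> = ereal k"
proof -
  have \<mu>L: "\<mu> \<in> Linf" using \<mu> by (auto simp: Linf_iff_bounded)
  have le: "Linf_norm \<mu> \<le> ereal k" using \<mu> by (simp add: Linf_norm_le_iff)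
  have ge: "ereal k \<le> Linf_norm \<nu>" if \<nu>: "\<nu> \<in> B_class \<mu>" for \<nu>
  proof (rule ccontr)
    assume "\<not> ereal k \<le> Linf_norm \<nu>"
    then have "Linf_norm \<nu> < ereal k" by simp
    then obtain c where c: "Linf_norm \<nu> < ereal c" "c < k" using ereal_dense2 by (metis less_ereal.simps(1))
    have \<nu>_meas: "\<nu> \<in> borel_measurable disc_measure"
      using \<nu> by (auto simp: inf_equiv_def Linf_iff_bounded)
    have \<nu>c: "AE z in disc_measure. norm (\<nu> z) \<le> c"
      using c(1) by (simp add: less_imp_le flip: Linf_norm_le_iff[OF \<nu>_meas])
    then have "AE z in disc_measure. norm (\<nu> z) \<le> k"
      by eventually_elim (use c(2) in simp)
    then have "AE z in disc_measure. Re z \<le> - 1/2 \<longrightarrow> \<nu> z = of_real k"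
      using \<nu> by (intro hamilton_forces_direction[OF p pU def0]) auto
    with \<nu>c have "AE z in disc_measure. Re z \<le> - 1/2 \<longrightarrow> \<bar>k\<bar> \<le> c"
      by eventually_elim auto
    from AE_disc_open_witness[OF this left_open(1) _ left_open(2)] have "\<bar>k\<bar> \<le> c"
      by (metis Int_iff inf_le1 less_imp_le mem_Collect_eq)
    with c(2) show False by simp
  qed
  have self: "\<mu> \<in> B_class \<mu>" using \<mu>L by (auto simp: inf_equiv_def)
  show eq: "Linf_norm \<mu> = ereal k" using le ge[OF self] by (rule antisym)
  have "(INF \<nu>\<in>B_class \<mu>. Linf_norm \<nu>) = ereal k"
  proof (rule antisym)
    show "(INF \<nu>\<in>B_class \<mu>. Linf_norm \<nu>) \<le> ereal k"
      using INF_lower[OF self, of Linf_norm] eq by simp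
    show "ereal k \<le> (INF \<nu>\<in>B_class \<mu>. Linf_norm \<nu>)"
      by (rule INF_greatest) (rule ge)
  qed
  with eq \<mu>L show "extremal \<mu>" by (simp add: extremal_def)
qed

theorem corollary2:
  shows "\<exists>P\<in>B_disc.
    (\<exists>\<mu>\<in>P. \<exists>\<nu>\<in>P. extremal_beltrami_coefficient \<mu> \<and> extremal_beltrami_coefficient \<nu> \<and>
       \<not> Linf_eq \<mu> \<nu>) \<and>
    \<not> (\<exists>\<mu>\<in>P. extremal_beltrami_coefficient \<mu> \<and> teichmueller_beltrami_coefficient \<mu>)"
proof -
  interpret finite_measure disc_measure by (rule finite_measure_disc)
  obtain p :: "nat \<Rightarrow> complex \<Rightarrow> complex" and \<beta> :: "complex \<Rightarrow> complex" where
    p: "\<And>n. p n holomorphic_on UNIV" and \<beta>_meas: "\<beta> \<in> borel_measurable disc_measure" 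
    and \<beta>_le: "\<And>z. norm (\<beta> z) \<le> 1" and \<beta>_0: "\<And>z. Re z \<ge> 1/2 \<Longrightarrow> \<beta> z = 0" 
    and pU: "\<And>n z. z \<in> disc \<Longrightarrow> Re z \<le> - 1/2 \<Longrightarrow> norm (p n z - 1) \<le> (1/2) ^ n"
    and def0: "(\<lambda>n. LINT z|disc_measure. norm (p n z) - Re (\<beta> z * p n z)) \<longlonglongrightarrow> 0"
    using splice_direction by blast
  obtain \<eta> :: "complex \<Rightarrow> complex" and B where
    \<eta>_borel: "\<eta> \<in> borel_measurable borel" and \<eta>_le: "\<And>z. norm (\<eta> z) \<le> 1"
    and \<eta>_0: "\<And>z. z \<notin> ball (3/4) (1/5) \<Longrightarrow> \<eta> z = 0"
    and B: "open B" "B \<noteq> {}" "B \<subseteq> ball (3/4) (1/5)" and \<eta>_B: "\<And>z. z \<in> B \<Longrightarrow> \<eta> z = 1"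
    and annih: "\<And>\<psi>. \<psi> holomorphic_on disc \<Longrightarrow> (LINT z|disc_measure. \<eta> z * \<psi> z) = 0"
    using annihilator_exists by blast
  have \<eta>_meas: "\<eta> \<in> borel_measurable disc_measure"
    using \<eta>_borel by (intro measurable_restrict_space1 measurable_completion) auto
  have ball_right: "Re z \<ge> 1/2" "z \<in> disc" if "z \<in> ball (3/4) (1/5)" for z :: complex
  proof -
    have n: "norm (3/4 - z) < 1/5" using that by (simp add: dist_norm)
    then show "Re z \<ge> 1/2" using abs_Re_le_cmod[of "3/4 - z"] by simp
    show "z \<in> disc" using norm_triangle_ineq4[of "3/4" "3/4 - z"] n by simp
  qed
  define \<mu> where "\<mu> = (\<lambda>z. \<beta> z / 2)"
  \<comment> \<open>The supports of \<open>\<beta>\<close> and \<open>\<eta>\<close> are disjoint, so the sum is still bounded by 1/2.\<close>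
  define \<nu> where "\<nu> = (\<lambda>z. \<beta> z / 2 + \<eta> z / 2)"
  have \<mu>_meas: "\<mu> \<in> borel_measurable disc_measure" and \<nu>_meas: "\<nu> \<in> borel_measurable disc_measure"
    unfolding \<mu>_def \<nu>_def using \<beta>_meas \<eta>_meas by measurable
  have \<mu>_le: "norm (\<mu> z) \<le> 1/2" for z using \<beta>_le[of z] by (simp add: \<mu>_def norm_divide)
  have \<nu>_le: "norm (\<nu> z) \<le> 1/2" for z
  proof (cases "z \<in> ball (3/4) (1/5)")
    case True
    then show ?thesis using \<beta>_0 ball_right(1) \<eta>_le[of z] by (simp add: \<nu>_def norm_divide)
  next
    case False
    then show ?thesis using \<eta>_0 \<beta>_le[of z] by (simp add: \<nu>_def norm_divide)
  qed
  have \<mu>L: "\<mu> \<in> Linf" and \<nu>L: "\<nu> \<in> Linf"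
    unfolding Linf_iff_bounded using \<mu>_meas \<nu>_meas \<mu>_le \<nu>_le
    by (auto intro!: exI[of _ "1/2"] simp del: divide_le_eq_numeral1)
  have equiv: "(\<mu>, \<nu>) \<in> inf_equiv"
    unfolding inf_equiv_def
  proof (clarsimp simp: \<mu>L \<nu>L)
    fix \<phi> assume \<phi>: "\<phi> \<in> A_disc"
    have i1: "integrable disc_measure (\<lambda>z. \<mu> z * \<phi> z)" 
      and i2: "integrable disc_measure (\<lambda>z. \<nu> z * \<phi> z)"
      using integrable_Linf_mult[OF _ \<phi>] \<mu>L \<nu>L by auto
    have "(LINT z|disc_measure. \<nu> z * \<phi> z) - (LINT z|disc_measure. \<mu> z * \<phi> z) =
        (LINT z|disc_measure. \<nu> z * \<phi> z - \<mu> z * \<phi> z)"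
      by (rule Bochner_Integration.integral_diff[OF i2 i1, symmetric])
    also have "\<dots> = (LINT z|disc_measure. (\<eta> z * \<phi> z) / 2)"
      by (intro Bochner_Integration.integral_cong) (auto simp: \<mu>_def \<nu>_def field_simps)
    also have "\<dots> = 0" using annih[of \<phi>] \<phi> by (simp add: A_disc_def)
    finally show "(LINT z|disc_measure. \<mu> z * \<phi> z) = (LINT z|disc_measure. \<nu> z * \<phi> z)" by simp
  qed
  have def\<mu>: "(\<lambda>n. LINT z|disc_measure. 1/2 * norm (p n z) - Re (\<mu> z * p n z)) \<longlonglongrightarrow> 0"
  proof -
    have "(\<lambda>n. 1/2 * (LINT z|disc_measure. norm (p n z) - Re (\<beta> z * p n z))) \<longlonglongrightarrow> 1/2 * 0"
      by (intro tendsto_intros def0)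
    moreover have "1/2 * (LINT z|disc_measure. norm (p n z) - Re (\<beta> z * p n z)) =
        (LINT z|disc_measure. 1/2 * norm (p n z) - Re (\<mu> z * p n z))" for n
      unfolding integral_mult_right_zero[symmetric] \<mu>_def
      by (intro Bochner_Integration.integral_cong) (auto simp: field_simps)
    ultimately show ?thesis by simp
  qed
  have classes: "B_class \<nu> = B_class \<mu>"
    using equiv_class_eq[OF equiv_inf_equiv equiv] by simp
  have ext\<mu>: "extremal \<mu>" "Linf_norm \<mu> = ereal (1/2)"
    using hamilton_extremal[OF p pU def\<mu> \<mu>_meas] \<mu>_le by auto
  have "Linf_norm \<nu> \<le> ereal (1/2)" using \<nu>_le by (simp add: Linf_norm_le_iff[OF \<nu>_meas])
  moreover have "Linf_norm \<mu> \<le> Linf_norm \<nu>"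
    using ext\<mu>(1) equiv unfolding extremal_def by (auto intro!: INF_lower)
  ultimately have ext\<nu>: "Linf_norm \<nu> = ereal (1/2)" "extremal \<nu>"
    using ext\<mu> \<nu>L classes by (auto simp: extremal_def)
  have ne: "\<not> Linf_eq \<mu> \<nu>"
  proof
    assume "Linf_eq \<mu> \<nu>"
    then have "AE z in disc_measure. \<mu> z = \<nu> z" by (simp add: Linf_eq_def)
    moreover have "B \<subseteq> disc" using B(3) ball_right(2) by blast
    ultimately obtain z where "z \<in> B" "\<mu> z = \<nu> z"
      using AE_disc_open_witness[of "\<lambda>z. \<mu> z = \<nu> z" B] B by blast
    with \<eta>_B show False by (simp add: \<mu>_def \<nu>_def)
  qed
  have no_teich: False
    if \<tau>: "\<tau> \<in> B_class \<mu>" and ext: "extremal \<tau>" and teich: "teichmueller_beltrami_coefficient \<tau>" for \<tau>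
  proof -
    have eq: "(\<mu>, \<tau>) \<in> inf_equiv" using \<tau> by auto
    have \<tau>_meas: "\<tau> \<in> borel_measurable disc_measure" using eq by (auto simp: inf_equiv_def Linf_iff_bounded)
    have "B_class \<tau> = B_class \<mu>" using equiv_class_eq[OF equiv_inf_equiv eq] by simp
    then have "Linf_norm \<tau> = ereal (1/2)" using ext ext\<mu> by (simp add: extremal_def)
    then have \<tau>_le: "AE z in disc_measure. norm (\<tau> z) \<le> 1/2"
      using Linf_norm_le_iff[OF \<tau>_meas, of "1/2"] by simp
    have forced: "AE z in disc_measure. Re z \<le> - 1/2 \<longrightarrow> \<tau> z = of_real (1/2)"
      by (rule hamilton_forces_direction[OF p pU def\<mu> eq \<tau>_le])
    obtain k \<phi> where k\<phi>: "\<phi> meromorphic_on disc" "\<not> (\<forall>\<^sub>\<approx>z\<in>disc. \<phi> z = 0)"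
      "AE z in disc_measure. \<tau> z = of_real k * cnj (\<phi> z) / of_real (norm (\<phi> z))"
      using teich unfolding teichmueller_beltrami_coefficient_def by blast
    have "AE z in disc_measure. z \<in> disc \<inter> {z. Re z < - 1/2} \<longrightarrow> \<tau> z = of_real (1/2)"
      using forced by eventually_elim auto
    then have half: "AE z in disc_measure. \<tau> z = of_real (1/2)"
      by (intro teichmueller_constant_on_open_set[OF k\<phi> left_open(1) _ left_open(2)]) auto
    have \<mu>_int: "integrable disc_measure \<mu>"
      using \<mu>_le \<mu>_meas by (intro integrable_const_bound[where B = "1/2"]) auto
    \<comment> \<open>Testing the equivalence with the constant function 1 forces the real part of \<open>\<mu>\<close> to be
      1/2 almost everywhere, but \<open>\<mu> = 0\<close> on the right part.\<close>
    have "(LINT z|disc_measure. \<mu> z * 1) = (LINT z|disc_measure. \<tau> z * 1)"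
      using eq A_disc_entire[of "\<lambda>_. 1"] by (auto simp: inf_equiv_def)
    also have "\<dots> = (LINT z|disc_measure. of_real (1/2))"
      using half \<tau>_meas by (intro integral_cong_AE) auto
    finally have "(LINT z|disc_measure. of_real (1/2) - \<mu> z) = 0"
      using \<mu>_int by simp
    then have "(LINT z|disc_measure. Re (of_real (1/2) - \<mu> z)) = 0"
      using \<mu>_int by (subst integral_Re) auto
    moreover have nonneg: "AE z in disc_measure. 0 \<le> Re (of_real (1/2) - \<mu> z)"
    proof (rule AE_I2)
      fix z
      show "0 \<le> Re (of_real (1/2) - \<mu> z)"
        using order_trans[OF complex_Re_le_cmod \<mu>_le[of z]] by simp
    qed
    moreover have int: "integrable disc_measure (\<lambda>z. Re (of_real (1/2) - \<mu> z))"
      using \<mu>_int by (intro integrable_Re Bochner_Integration.integrable_diff) auto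
    ultimately have zero: "AE z in disc_measure. Re (of_real (1/2) - \<mu> z) = 0"
      using integral_nonneg_eq_0_iff_AE[OF int nonneg] by blast
    have sub: "ball (3/4) (1/5) \<subseteq> disc" using ball_right(2) by blast
    obtain z where "z \<in> ball (3/4) (1/5)" "Re (of_real (1/2) - \<mu> z) = 0"
      using AE_disc_open_witness[OF zero open_ball sub] by auto
    then show False using \<beta>_0 ball_right(1) by (simp add: \<mu>_def)
  qed
  have P: "B_class \<mu> \<in> B_disc" unfolding B_disc_def using \<mu>L by (rule quotientI)
  have "\<mu> \<in> B_class \<mu>" "\<nu> \<in> B_class \<mu>" using equiv \<mu>L by (auto simp: inf_equiv_def)
  moreover have "extremal_beltrami_coefficient \<mu>" "extremal_beltrami_coefficient \<nu>"
    using ext\<mu> ext\<nu> \<mu>L \<nu>L by (auto simp: extremal_beltrami_coefficient_def beltrami_coefficient_def)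
  ultimately show ?thesis
    using P ne no_teich unfolding extremal_beltrami_coefficient_def by blast
qed

end
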